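(* Let $(A,\cdot_\lambda\cdot)$ be a finite associative conformal algebra which is free as a $\mathbb{C}[\partial]$-module. Suppose there is another associative conformal algebra structure on the $\mathbb{C}[\partial]$-module $A^{\ast c}$ obtained from a $\mathbb{C}[\partial]$-module homomorphism $\Delta:A\to A\otimes A$. Then the following conditions are equivalent: (1) $(A,\cdot_\lambda\cdot,\Delta)$ is an antisymmetric infinitesimal (ASI) conformal bialgebra; (2) there is a double construction of Frobenius conformal algebra associated to $A$ and $A^{\ast c}$; (3) $(A,A^{\ast c},R_A^\ast,L_A^\ast,R_{A^{\ast c}}^\ast,L_{A^{\ast c}}^\ast)$ is a matched pair of associative conformal algebras.
   Context: Everything is over $\mathbb{C}$. An associative conformal algebra is a $\mathbb{C}[\partial]$-module $A$ with a $\mathbb{C}$-bilinear map $A\times A\to A[\lambda]$, $(a,b)\mapsto a_\lambda b$, such that $(\partial a)_\lambda b=-\lambda a_\lambda b$, $a_\lambda(\partial b)=(\partial+\lambda)(a_\lambda b)$ and $(a_\lambda b)_{\lambda+\mu}c=a_\lambda(b_\mu c)$. It is finite if finitely generated as a $\mathbb{C}[\partial]$-module. Subalgebras are $\mathbb{C}[\partial]$-submodules closed under the $\lambda$-product. Conventions: $x_{-\lambda-\partial}y$ means: write $x_\nu y=\sum_k\nu^k c_k$ and take $\sum_k(-\lambda-\partial)^kc_k$, with $\partial$ acting on the $c_k$ (similarly for $\phi_{-\lambda-\partial}v$). Write $\partial^{\otimes^2}=\partial\otimes1+1\otimes\partial$; $\mathbb{C}[\partial]$ acts on $A\otimes A$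 through $\partial^{\otimes^2}$. For operators such as $I\otimes R_A(b)_\nu:A\otimes A\to(A\otimes A)[\nu]$, the subscript $\nu=-\lambda-\partial^{\otimes^2}$ means that in the output each $\nu^k$ is replaced by $(-\lambda-\partial^{\otimes^2})^k$ acting on its coefficient in $A\otimes A$. $\tau(x\otimes y)=y\otimes x$. $Chom(U,V)$: $\mathbb{C}$-linear maps $a_\lambda:U\to V[\lambda]$ with $a_\lambda(\partial u)=(\partial+\lambda)a_\lambda u$, a $\mathbb{C}[\partial]$-module via $(\partial a)_\lambda=-\lambda a_\lambda$; $Cend(V)=Chom(V,V)$; the conformal dual is $U^{\ast c}=Chom(U,\mathbb{C})$, $\mathbb{C}$ with $\partial=0$. The structure on $A^{\ast c}$ obtained from $\Delta$ is $(f_\lambda g)_\mu(a)=\sum f_\lambda(a_{(1)})g_{\mu-\lambda}(a_{(2)})$, where $\Delta(a)=\sum a_{(1)}\otimes a_{(2)}$. $L_A(a)_\lambda b=a_\lambda b$, $R_A(a)_\lambda b=b_{-\lambda-\partial}a$. An associative conformal coalgebra is a $\mathbb{C}[\partial]$-module $A$ with a $\mathbb{C}[\partial]$-module homomorphism $\Delta:A\to A\otimes A$ with $(I\otimes\Delta)\Delta=(\Delta\otimes I)\Delta$. An ASI conformal bialgebra $(A,\cdot_\lambda\cdot,\Delta)$ consists of an associative conformal algebra $(A,\cdot_\lambda\cdot)$ and an associative conformal coalgebra $(A,\Delta)$ such that for all $a,b\in A$ $\Delta(a_\lambda b)=(I\otimes L_A(a)_\lambda)\Delta(b)+(R_A(b)_{-\lambda-\partial^{\otimes^2}}\otimes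 I)\Delta(a)$ and $(L_A(b)_{-\lambda-\partial^{\otimes^2}}\otimes I-I\otimes R_A(b)_{-\lambda-\partial^{\otimes^2}})\Delta(a)+\tau(L_A(a)_\lambda\otimes I-I\otimes R_A(a)_\lambda)\Delta(b)=0$. Bimodule $(M,l_A,r_A)$ of $A$: a $\mathbb{C}[\partial]$-module $M$ with $\mathbb{C}[\partial]$-module homomorphisms $l_A,r_A:A\to Cend(M)$ such that $l_A(a_\lambda b)_{\lambda+\mu}v=l_A(a)_\lambda(l_A(b)_\mu v)$, $r_A(b)_{-\lambda-\mu-\partial}(r_A(a)_{-\lambda-\partial}v)=r_A(a_\mu b)_{-\lambda-\partial}v$, $l_A(a)_\lambda(r_A(b)_{-\mu-\partial}v)=r_A(b)_{-\lambda-\mu-\partial}(l_A(a)_\lambda v)$. The duals $L_A^\ast,R_A^\ast:A\to Cend(A^{\ast c})$ are $(L_A^\ast(a)_\lambda f)_\mu b=f_{\mu-\lambda}(L_A(a)_\lambda b)$, $(R_A^\ast(a)_\lambda f)_\mu b=f_{\mu-\lambda}(R_A(a)_\lambda b)$. Likewise $L_{A^{\ast c}}^\ast,R_{A^{\ast c}}^\ast:A^{\ast c}\to Cend(A)$ are defined from the algebra $A^{\ast c}$ after identifying $A\cong (A^{\ast c})^{\ast c}$ by $a_\mu(h)=h_{-\mu}(a)$; explicitly $h_{-\mu}(L_{A^{\ast c}}^\ast(f)_\lambda a)=(f_\lambda h)_{\lambda-\mu}(a)$ and $h_{-\mu}(R_{A^{\ast c}}^\ast(f)_\lambda a)=(R_{A^{\ast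 c}}(f)_\lambda h)_{\lambda-\mu}(a)$ with $R_{A^{\ast c}}(f)_\lambda h=h_{-\lambda-\partial}f$. Matched pair $(A,B,l_A,r_A,l_B,r_B)$: $A,B$ are associative conformal algebras, $(B,l_A,r_A)$ is a bimodule of $A$, $(A,l_B,r_B)$ is a bimodule of $B$, and for all $a,b\in A$, $x,y\in B$: (i) $l_A(a)_\lambda(x_\mu y)=(l_A(a)_\lambda x)_{\lambda+\mu}y+l_A(r_B(x)_{-\lambda-\partial}a)_{\lambda+\mu}y$; (ii) $r_B(x)_{-\lambda-\mu-\partial}(a_\lambda b)=a_\lambda(r_B(x)_{-\mu-\partial}b)+r_B(l_A(b)_\mu x)_{-\lambda-\partial}a$; (iii) $l_B(x)_\lambda(a_\mu b)=(l_B(x)_\lambda a)_{\lambda+\mu}b+l_B(r_A(a)_{-\lambda-\partial}x)_{\lambda+\mu}b$; (iv) $r_A(l_B(y)_\mu a)_{-\lambda-\partial}x+x_\lambda(r_A(a)_{-\mu-\partial}y)=r_A(a)_{-\lambda-\mu-\partial}(x_\lambda y)$; (v) $r_A(r_B(y)_{-\mu-\partial}a)_{-\lambda-\partial}x+x_\lambda(l_A(a)_\mu y)=l_A(l_B(x)_\lambda a)_{\lambda+\mu}y+(r_A(a)_{-\lambda-\partial}x)_{\lambda+\mu}y$; (vi) $a_\lambda(l_B(x)_\mu b)+r_B(r_A(b)_{-\mu-\partial}x)_{-\lambda-\partial}a=(r_B(x)_{-\lambda-\partial}a)_{\lambda+\mu}b+l_B(l_A(a)_\lambda x)_{\lambda+\mu}b$.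 A conformal bilinear form on a $\mathbb{C}[\partial]$-module $V$ is a $\mathbb{C}$-bilinear map $\langle\cdot,\cdot\rangle_\lambda:V\times V\to\mathbb{C}[\lambda]$ with $\langle\partial a,b\rangle_\lambda=-\lambda\langle a,b\rangle_\lambda$, $\langle a,\partial b\rangle_\lambda=\lambda\langle a,b\rangle_\lambda$. It is non-degenerate if $v\mapsto\langle v,\cdot\rangle_\lambda$ is an isomorphism $V\to V^{\ast c}$ of $\mathbb{C}[\partial]$-modules. A Frobenius conformal algebra is an associative conformal algebra with a non-degenerate conformal bilinear form such that $\langle a_\lambda b,c\rangle_\mu=\langle a,b_{\mu-\partial}c\rangle_\lambda$ for all $a,b,c$ (the right side equals $\langle a,b_{\mu-\lambda}c\rangle_\lambda$). A double construction of Frobenius conformal algebra associated to $B$ and $B^{\ast c}$ (both with given associative conformal algebra structures) is a Frobenius conformal algebra which is $B\oplus B^{\ast c}$ as a $\mathbb{C}[\partial]$-module, in which $B$ and $B^{\ast c}$ are associative conformal subalgebras, and whose form is $\langle a+f,b+g\rangle_\lambda=f_\lambda(b)+g_{-\lambda}(a)$ for $a,b\in B$, $f,g\in B^{\ast c}$. *)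

theory Defs
  imports
    Complex_Main
    "HOL-Computational_Algebra.Polynomial"
    "HOL-Library.Poly_Mapping"
    "HOL-Library.Product_Plus"
begin

section \<open>Complex vector spaces and \<open>\<complex>[\<partial>]\<close>-modules\<close>

class cvec = ab_group_add +
  fixes cscale :: "complex \<Rightarrow> 'a \<Rightarrow> 'a"
  assumes cscale_add_right: "cscale c (x + y) = cscale c x + cscale c y"
    and cscale_add_left: "cscale (c + d) x = cscale c x + cscale d x"
    and cscale_cscale: "cscale c (cscale d x) = cscale (c * d) x"
    and cscale_one: "cscale 1 x = x"

class cdmod = cvec +
  fixes der :: "'a \<Rightarrow> 'a"
  assumes der_add: "der (x + y) = der x + der y"
    and der_cscale: "der (cscale c x) = cscale c (der x)"

global_interpretation cv: vector_space "cscale :: complex \<Rightarrow> 'a \<Rightarrow> 'a::cvec"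
  by unfold_locales (simp_all add: cscale_add_right cscale_add_left cscale_cscale cscale_one)

abbreviation clinear :: "('a::cvec \<Rightarrow> 'b::cvec) \<Rightarrow> bool" where
  "clinear \<equiv> Vector_Spaces.linear cscale cscale"

definition cbilinear :: "('a::cvec \<Rightarrow> 'b::cvec \<Rightarrow> 'c::cvec) \<Rightarrow> bool" where
  "cbilinear f \<longleftrightarrow> (\<forall>y. clinear (\<lambda>x. f x y)) \<and> (\<forall>x. clinear (f x))"

lemma clinear_iff:
  "clinear f \<longleftrightarrow> (\<forall>x y. f (x + y) = f x + f y) \<and> (\<forall>c x. f (cscale c x) = cscale c (f x))"
  using Vector_Spaces.linear_iff[of cscale cscale f]
  by (simp add: cv.vector_space_axioms)

lemma clinear_0: "clinear f \<Longrightarrow> f 0 = 0"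
  by (metis add_cancel_right_right clinear_iff)

lemma clinear_add: "clinear f \<Longrightarrow> f (x + y) = f x + f y"
  by (simp add: clinear_iff)

lemma clinear_cscale: "clinear f \<Longrightarrow> f (cscale c x) = cscale c (f x)"
  by (simp add: clinear_iff)

lemma clinear_minus: "clinear f \<Longrightarrow> f (- x) = - f x"
  by (metis add.right_inverse add_eq_0_iff clinear_0 clinear_add)

lemma clinear_diff: "clinear f \<Longrightarrow> f (x - y) = f x - f y"
  by (metis add_diff_cancel_right' clinear_add diff_add_cancel)

lemma clinear_sum: "clinear f \<Longrightarrow> f (sum g S) = (\<Sum>x\<in>S. f (g x))"
  by (induct S rule: infinite_finite_induct) (auto simp: clinear_0 clinear_add)

lemma clinear_der: "clinear der"
  by (simp add: clinear_iff der_add der_cscale)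

lemma clinear_funpow:
  fixes T :: "'a::cvec \<Rightarrow> 'a"
  shows "clinear T \<Longrightarrow> clinear (T ^^ k)"
  by (induct k) (auto simp: clinear_iff)

lemma clinear_cscale_fun: "clinear (cscale c)"
  by (simp add: clinear_iff cscale_add_right cscale_cscale mult.commute)

lemma cbilinearI:
  assumes "\<And>x x' y. f (x + x') y = f x y + f x' y" "\<And>c x y. f (cscale c x) y = cscale c (f x y)"
    "\<And>x y y'. f x (y + y') = f x y + f x y'" "\<And>c x y. f x (cscale c y) = cscale c (f x y)"
  shows "cbilinear f"
  using assms by (auto simp: cbilinear_def clinear_iff)

lemma cbilinearD:
  assumes "cbilinear f"
  shows "f (x + x') y = f x y + f x' y" "f (cscale c x) y = cscale c (f x y)"
    "f x (y + y') = f x y + f x y'" "f x (cscale c y) = cscale c (f x y)"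
  using assms by (auto simp: cbilinear_def clinear_iff)

definition pscale :: "complex poly \<Rightarrow> 'a::cdmod \<Rightarrow> 'a" where
  "pscale p x = (\<Sum>k\<le>degree p. cscale (coeff p k) ((der ^^ k) x))"

lemma pscale_bound:
  assumes "degree p \<le> n"
  shows "pscale p x = (\<Sum>k\<le>n. cscale (coeff p k) ((der ^^ k) x))"
  unfolding pscale_def
  by (rule sum.mono_neutral_left) (use assms in \<open>auto simp: coeff_eq_0\<close>)

lemma pscale_0: "pscale 0 x = 0"
  by (simp add: pscale_def)

lemma pscale_add_left: "pscale (p + q) x = pscale p x + pscale q x"
proof -
  let ?n = "max (degree p) (degree q)"
  have "degree (p + q) \<le> ?n" by (rule degree_add_le_max)
  then show ?thesis
    by (simp add: pscale_bound[of _ ?n] cscale_add_left sum.distrib)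
qed

lemma pscale_pCons: "pscale (pCons c p) x = cscale c x + der (pscale p x)"
proof -
  have "degree (pCons c p) \<le> Suc (degree p)" by (rule degree_pCons_le)
  then have "pscale (pCons c p) x
      = (\<Sum>k\<le>Suc (degree p). cscale (coeff (pCons c p) k) ((der ^^ k) x))"
    by (rule pscale_bound)
  also have "\<dots> = cscale c x + (\<Sum>k\<le>degree p. cscale (coeff p k) (der ((der ^^ k) x)))"
    by (subst sum.atMost_Suc_shift) simp
  also have "\<dots> = cscale c x + der (pscale p x)"
    by (simp add: pscale_def clinear_sum[OF clinear_der] der_cscale)
  finally show ?thesis .
qed

lemma clinear_pscale: "clinear (pscale p)"
proof -
  have *: "clinear (der ^^ k :: 'a \<Rightarrow> 'a)" for k by (rule clinear_funpow[OF clinear_der])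
  show ?thesis
    unfolding clinear_iff pscale_def
    by (auto simp: clinear_add[OF *] clinear_cscale[OF *] cscale_add_right sum.distrib
        cscale_cscale cv.scale_sum_right mult.commute)
qed

lemma pscale_smult: "pscale (smult c p) x = cscale c (pscale p x)"
  by (induct p) (simp_all add: pscale_0 pscale_pCons cscale_cscale cscale_add_right der_cscale)

lemma pscale_mult: "pscale (p * q) x = pscale p (pscale q x)"
  by (induct p) (simp_all add: pscale_0 pscale_pCons pscale_add_left pscale_smult)

lemma pscale_var: "pscale [:0, 1:] x = der x"
  by (simp add: pscale_pCons pscale_0 cscale_one clinear_0[OF clinear_der])

lemma pscale_const: "pscale [:c:] x = cscale c x"
  by (simp add: pscale_pCons pscale_0 clinear_0[OF clinear_der])

global_interpretation cd: module "pscale :: complex poly \<Rightarrow> 'a \<Rightarrow> 'a::cdmod"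
  by unfold_locales
    (simp_all add: clinear_add[OF clinear_pscale] pscale_add_left pscale_mult
      one_pCons pscale_const cscale_one)

abbreviation cd_hom :: "('a::cdmod \<Rightarrow> 'b::cdmod) \<Rightarrow> bool" where
  "cd_hom \<equiv> module_hom pscale pscale"

lemma cd_hom_iff: "cd_hom f \<longleftrightarrow> clinear f \<and> (\<forall>x. f (der x) = der (f x))"
proof
  assume f: "cd_hom f"
  interpret module_hom pscale pscale f by (rule f)
  show "clinear f \<and> (\<forall>x. f (der x) = der (f x))"
    unfolding clinear_iff by (metis add scale pscale_const pscale_var)
next
  assume f: "clinear f \<and> (\<forall>x. f (der x) = der (f x))"
  have "f (pscale p x) = pscale p (f x)" for p x
    by (induct p) (use f in \<open>auto simp: pscale_0 pscale_pCons clinear_0 clinear_add clinear_cscale\<close>)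
  then show "cd_hom f"
    using f by unfold_locales (auto simp: clinear_add)
qed

instantiation complex :: cdmod
begin
definition cscale_complex :: "complex \<Rightarrow> complex \<Rightarrow> complex" where "cscale_complex = (*)"
definition der_complex :: "complex \<Rightarrow> complex" where "der_complex x = 0"
instance
  by standard (simp_all add: cscale_complex_def der_complex_def algebra_simps)
end

instantiation prod :: (cvec, cvec) cvec
begin
definition cscale_prod :: "complex \<Rightarrow> 'a \<times> 'b \<Rightarrow> 'a \<times> 'b" where
  "cscale_prod c x = (cscale c (fst x), cscale c (snd x))"
instance
  by standard (auto simp: cscale_prod_def cscale_add_right cscale_add_left cscale_cscale cscale_one prod_eq_iff)
end

instantiation prod :: (cdmod, cdmod) cdmod
begin
definition der_prod :: "'a \<times> 'b \<Rightarrow> 'a \<times> 'b" where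
  "der_prod x = (der (fst x), der (snd x))"
instance
  by standard (auto simp: der_prod_def cscale_prod_def der_add der_cscale)
end

section \<open>Polynomials with coefficients in a \<open>\<complex>[\<partial>]\<close>-module\<close>

text \<open>
  The spectral parameter, usually called lambda, is written \<open>\<kappa>\<close>. The space \<open>V[\<kappa>]\<close> is \<open>'v poly\<close>,
  and \<open>\<partial>\<close> acts on the coefficients.
\<close>

instantiation poly :: (cvec) cvec
begin
definition cscale_poly :: "complex \<Rightarrow> 'a poly \<Rightarrow> 'a poly" where
  "cscale_poly c = map_poly (cscale c)"
instance
  by standard (auto simp: cscale_poly_def poly_eq_iff coeff_map_poly cscale_add_right
      cscale_add_left cscale_cscale cscale_one)
end

instantiation poly :: (cdmod) cdmod
begin
definition der_poly :: "'a poly \<Rightarrow> 'a poly" where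
  "der_poly = map_poly der"
instance
  by standard (auto simp: cscale_poly_def der_poly_def poly_eq_iff coeff_map_poly
      der_add der_cscale clinear_0[OF clinear_der])
end

lemma coeff_cscale: "coeff (cscale c p) k = cscale c (coeff p k)"
  by (simp add: cscale_poly_def coeff_map_poly)

lemma coeff_der: "coeff (der p) k = der (coeff p k)"
  by (simp add: der_poly_def coeff_map_poly clinear_0[OF clinear_der])

definition psubst :: "('v \<Rightarrow> 'v) \<Rightarrow> 'v::cvec poly \<Rightarrow> 'v" where
  "psubst T p = (\<Sum>k\<le>degree p. (T ^^ k) (coeff p k))"

text \<open>
  \<open>pev p \<kappa>\<close> is the value of \<open>p\<close> at \<open>\<kappa> \<in> \<complex>\<close>, and \<open>pevd p \<kappa>\<close> is \<open>p\<^bsub>-\<kappa>-\<partial>\<^esub>\<close>.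
  An identity in \<open>V[\<kappa>]\<close> or \<open>V[\<kappa>, \<mu>]\<close> is stated below as the identity of values at all complex
  \<open>\<kappa>\<close>, \<open>\<mu>\<close>; by \<open>pev_inject\<close>, applied to one variable after the other, nothing is lost.
\<close>

definition pev :: "'v::cvec poly \<Rightarrow> complex \<Rightarrow> 'v" where
  "pev p \<kappa> = psubst (cscale \<kappa>) p"

definition pevd :: "'v::cdmod poly \<Rightarrow> complex \<Rightarrow> 'v" where
  "pevd p \<kappa> = psubst (\<lambda>v. - cscale \<kappa> v - der v) p"

text \<open>\<open>pflip p\<close> is \<open>p\<^bsub>-\<nu>-\<partial>\<^esub>\<close> expanded as a polynomial in the indeterminate \<open>\<nu>\<close>.\<close>

definition pflip :: "'v::cdmod poly \<Rightarrow> 'v poly" where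
  "pflip p = psubst (\<lambda>q. - pCons 0 q - der q) (map_poly (\<lambda>v. [:v:]) p)"

lemma psubst_bound:
  assumes "clinear T" "degree p \<le> n"
  shows "psubst T p = (\<Sum>k\<le>n. (T ^^ k) (coeff p k))"
  unfolding psubst_def
  by (rule sum.mono_neutral_left)
    (use assms in \<open>auto simp: coeff_eq_0 clinear_0[OF clinear_funpow]\<close>)

lemma clinear_psubst:
  assumes T: "clinear T"
  shows "clinear (psubst T)"
proof -
  have "psubst T (p + q) = psubst T p + psubst T q" for p q
  proof -
    let ?n = "max (degree p) (degree q)"
    have "degree (p + q) \<le> ?n" by (rule degree_add_le_max)
    then show ?thesis
      by (simp add: psubst_bound[OF T, of _ ?n] clinear_add[OF clinear_funpow[OF T]] sum.distrib)
  qed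
  moreover have "psubst T (cscale c p) = cscale c (psubst T p)" for c p
  proof -
    have "degree (cscale c p) \<le> degree p"
      by (rule degree_le) (simp add: coeff_cscale coeff_eq_0)
    then show ?thesis
      by (simp add: psubst_bound[OF T, of _ "degree p"] coeff_cscale
          clinear_cscale[OF clinear_funpow[OF T]] cv.scale_sum_right)
  qed
  ultimately show ?thesis by (simp add: clinear_iff)
qed

lemma psubst_pCons:
  assumes T: "clinear T"
  shows "psubst T (pCons v p) = v + T (psubst T p)"
proof -
  have "psubst T (pCons v p) = (\<Sum>k\<le>Suc (degree p). (T ^^ k) (coeff (pCons v p) k))"
    by (rule psubst_bound[OF T degree_pCons_le])
  also have "\<dots> = v + (\<Sum>k\<le>degree p. T ((T ^^ k) (coeff p k)))"
    by (subst sum.atMost_Suc_shift) simp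
  also have "\<dots> = v + T (psubst T p)"
    by (simp add: psubst_def clinear_sum[OF T])
  finally show ?thesis .
qed

lemma clinear_pev: "clinear (\<lambda>p. pev p \<kappa>)"
  unfolding pev_def by (rule clinear_psubst[OF clinear_cscale_fun])

lemma clinear_minus_der: "clinear (\<lambda>v. - cscale \<kappa> v - der v)"
  by (simp add: clinear_iff cscale_add_right der_add der_cscale cscale_cscale mult.commute
      cv.scale_right_diff_distrib)

lemma clinear_pevd: "clinear (\<lambda>p. pevd p \<kappa>)"
  unfolding pevd_def by (rule clinear_psubst[OF clinear_minus_der])

lemma pev_pCons: "pev (pCons v p) \<kappa> = v + cscale \<kappa> (pev p \<kappa>)"
  unfolding pev_def by (rule psubst_pCons[OF clinear_cscale_fun])

lemma pevd_pCons: "pevd (pCons v p) \<kappa> = v - cscale \<kappa> (pevd p \<kappa>) - der (pevd p \<kappa>)"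
  unfolding pevd_def by (simp add: psubst_pCons[OF clinear_minus_der])

lemma pev_0: "pev 0 \<kappa> = 0" and pevd_0: "pevd 0 \<kappa> = 0"
  by (simp_all add: pev_def pevd_def psubst_def)

lemma pev_complex: "pev p \<kappa> = poly p \<kappa>"
  by (induct p) (simp_all add: pev_0 pev_pCons cscale_complex_def)

lemma pev_map_poly: "clinear f \<Longrightarrow> pev (map_poly f p) \<kappa> = f (pev p \<kappa>)"
  by (induct p) (simp_all add: pev_0 pev_pCons clinear_0 clinear_add clinear_cscale map_poly_pCons)

lemma pev_der: "pev (der p) \<kappa> = der (pev p \<kappa>)"
  unfolding der_poly_def by (rule pev_map_poly[OF clinear_der])

lemma clinear_pCons_der: "clinear (\<lambda>q::'v::cdmod poly. - pCons 0 q - der q)"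
  unfolding clinear_iff
  by (auto simp: poly_eq_iff coeff_pCons coeff_der coeff_cscale der_add der_cscale
      cv.scale_right_diff_distrib split: nat.splits)

lemma pflip_pCons: "pflip (pCons v p) = [:v:] - pCons 0 (pflip p) - der (pflip p)"
  unfolding pflip_def
  by (simp add: map_poly_pCons psubst_pCons[OF clinear_pCons_der] add_diff_eq
      del: minus_pCons diff_pCons)

lemma pev_pflip: "pev (pflip p) \<kappa> = pevd p \<kappa>"
proof (induct p)
  case 0
  then show ?case by (simp add: pflip_def psubst_def pev_0 pevd_0)
next
  case (pCons v p)
  then show ?case
    by (simp add: pflip_pCons pevd_pCons pev_pCons pev_0 pev_der clinear_diff[OF clinear_pev]
        clinear_minus[OF clinear_pev])
qed

lemma pev_inject:
  assumes "\<And>\<kappa>. pev p \<kappa> = pev q \<kappa>"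
  shows "p = q"
proof (rule poly_eqI)
  fix n
  define B where "B = cv.extend_basis ({} :: 'a set)"
  have B: "cv.independent B" "cv.span B = UNIV"
    unfolding B_def by (simp_all add: cv.independent_extend_basis cv.independent_empty)
  define r where "r b v = cv.representation B v b" for b v
  have r: "clinear (r b)" for b
    unfolding clinear_iff
    by (simp add: r_def B cv.representation_add cv.representation_scale cscale_complex_def)
  have "r b (coeff p n) = r b (coeff q n)" for b
  proof -
    have "poly (map_poly (r b) p) \<kappa> = poly (map_poly (r b) q) \<kappa>" for \<kappa>
      by (simp add: pev_map_poly[OF r] assms flip: pev_complex)
    then have "map_poly (r b) p = map_poly (r b) q"
      using poly_eq_poly_eq_iff by blast
    then show ?thesis by (metis coeff_map_poly clinear_0[OF r])
  qed
  then have "cv.representation B (coeff p n) = cv.representation B (coeff q n)"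
    by (auto simp: r_def)
  then have "(\<Sum>b | cv.representation B (coeff p n) b \<noteq> 0. cscale (cv.representation B (coeff p n) b) b)
      = (\<Sum>b | cv.representation B (coeff q n) b \<noteq> 0. cscale (cv.representation B (coeff q n) b) b)"
    by (rule arg_cong)
  moreover have "(\<Sum>b | cv.representation B v b \<noteq> 0. cscale (cv.representation B v b) b) = v" for v
    by (rule cv.sum_nonzero_representation_eq) (simp_all add: B)
  ultimately show "coeff p n = coeff q n"
    by simp
qed

section \<open>Tensor products over \<open>\<complex>\<close>\<close>

text \<open>The free vector space on \<open>'a \<times> 'b\<close> modulo the bilinearity relations.\<close>

definition fscale :: "complex \<Rightarrow> ('x \<Rightarrow>\<^sub>0 complex) \<Rightarrow> ('x \<Rightarrow>\<^sub>0 complex)" where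
  "fscale c = Poly_Mapping.map ((*) c)"

lemma lookup_fscale: "Poly_Mapping.lookup (fscale c p) x = c * Poly_Mapping.lookup p x"
  by (simp add: fscale_def Poly_Mapping.map.rep_eq when_def)

global_interpretation free: vector_space "fscale :: complex \<Rightarrow> ('x \<Rightarrow>\<^sub>0 complex) \<Rightarrow> _"
  by unfold_locales
    (auto simp: poly_mapping_eq_iff fun_eq_iff lookup_fscale lookup_add algebra_simps)

abbreviation gen :: "'x \<Rightarrow> 'x \<Rightarrow>\<^sub>0 complex" where
  "gen x \<equiv> Poly_Mapping.single x 1"

definition tensor_relations :: "(('a::cvec \<times> 'b::cvec) \<Rightarrow>\<^sub>0 complex) set" where
  "tensor_relations =
     {gen (a + a', b) - gen (a, b) - gen (a', b) | a a' b. True} \<union>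
     {gen (a, b + b') - gen (a, b) - gen (a, b') | a b b'. True} \<union>
     {gen (cscale c a, b) - fscale c (gen (a, b)) | c a b. True} \<union>
     {gen (a, cscale c b) - fscale c (gen (a, b)) | c a b. True}"

definition tensor_eq ::
    "(('a::cvec \<times> 'b::cvec) \<Rightarrow>\<^sub>0 complex) \<Rightarrow> (('a \<times> 'b) \<Rightarrow>\<^sub>0 complex) \<Rightarrow> bool" where
  "tensor_eq p q \<longleftrightarrow> p - q \<in> free.span tensor_relations"

lemma equivp_tensor_eq:
  "equivp (tensor_eq :: ('a::cvec \<times> 'b::cvec \<Rightarrow>\<^sub>0 complex) \<Rightarrow> _)"
proof (rule equivpI)
  show "reflp (tensor_eq :: ('a \<times> 'b \<Rightarrow>\<^sub>0 complex) \<Rightarrow> _)"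
    by (simp add: reflp_def tensor_eq_def free.span_zero)
  show "symp (tensor_eq :: ('a \<times> 'b \<Rightarrow>\<^sub>0 complex) \<Rightarrow> _)"
    unfolding symp_def tensor_eq_def by (metis free.span_neg minus_diff_eq)
  show "transp (tensor_eq :: ('a \<times> 'b \<Rightarrow>\<^sub>0 complex) \<Rightarrow> _)"
  proof (rule transpI)
    fix p q r
    assume "tensor_eq p q" "tensor_eq q r"
    from free.span_add[OF this[unfolded tensor_eq_def]] show "tensor_eq p r"
      by (simp add: tensor_eq_def)
  qed
qed

quotient_type (overloaded) ('a, 'b) tensor =
    "('a::cvec \<times> 'b::cvec) \<Rightarrow>\<^sub>0 complex" / tensor_eq
  by (rule equivp_tensor_eq)

instantiation tensor :: (cvec, cvec) cvec
begin

lift_definition zero_tensor :: "('a, 'b) tensor" is 0 .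

lift_definition plus_tensor :: "('a, 'b) tensor \<Rightarrow> ('a, 'b) tensor \<Rightarrow> ('a, 'b) tensor" is "(+)"
  unfolding tensor_eq_def add_diff_add by (rule free.span_add)

lift_definition uminus_tensor :: "('a, 'b) tensor \<Rightarrow> ('a, 'b) tensor" is uminus
  unfolding tensor_eq_def minus_diff_minus by (rule free.span_neg)

lift_definition minus_tensor :: "('a, 'b) tensor \<Rightarrow> ('a, 'b) tensor \<Rightarrow> ('a, 'b) tensor" is "(-)"
proof -
  fix p q p' q' :: "('a::cvec \<times> 'b::cvec) \<Rightarrow>\<^sub>0 complex"
  assume "tensor_eq p q" "tensor_eq p' q'"
  from free.span_diff[OF this[unfolded tensor_eq_def]] show "tensor_eq (p - p') (q - q')"
    by (simp add: tensor_eq_def algebra_simps)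
qed

lift_definition cscale_tensor :: "complex \<Rightarrow> ('a, 'b) tensor \<Rightarrow> ('a, 'b) tensor" is fscale
  unfolding tensor_eq_def free.scale_right_diff_distrib[symmetric] by (rule free.span_scale)

instance
  by standard (transfer, simp add: tensor_eq_def algebra_simps free.span_zero)+

end

lift_definition tens :: "'a::cvec \<Rightarrow> 'b::cvec \<Rightarrow> ('a, 'b) tensor" (infixl "\<otimes>" 71)
  is "\<lambda>a b. gen (a, b)" .

lemma cbilinear_tens: "cbilinear (\<otimes>)"
proof (rule cbilinearI; transfer)
  fix x x' :: 'a and y y' :: 'b and c
  have *: "p \<in> tensor_relations \<Longrightarrow> p \<in> free.span tensor_relations"
    for p :: "('a \<times> 'b) \<Rightarrow>\<^sub>0 complex" by (rule free.span_base)
  show "tensor_eq (gen (x + x', y)) (gen (x, y) + gen (x', y))"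
    unfolding tensor_eq_def diff_diff_add[symmetric] by (rule *) (unfold tensor_relations_def, blast)
  show "tensor_eq (gen (x, y + y')) (gen (x, y) + gen (x, y'))"
    unfolding tensor_eq_def diff_diff_add[symmetric] by (rule *) (unfold tensor_relations_def, blast)
  show "tensor_eq (gen (cscale c x, y)) (fscale c (gen (x, y)))"
    unfolding tensor_eq_def by (rule *) (unfold tensor_relations_def, blast)
  show "tensor_eq (gen (x, cscale c y)) (fscale c (gen (x, y)))"
    unfolding tensor_eq_def by (rule *) (unfold tensor_relations_def, blast)
qed

text \<open>\<open>tlift f\<close> is the linear map with \<open>a \<otimes> b \<mapsto> f a b\<close>; it is only meaningful for bilinear \<open>f\<close>.\<close>

definition free_extend :: "('x \<Rightarrow> 'c::cvec) \<Rightarrow> ('x \<Rightarrow>\<^sub>0 complex) \<Rightarrow> 'c" where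
  "free_extend f p = (\<Sum>x\<in>Poly_Mapping.keys p. cscale (Poly_Mapping.lookup p x) (f x))"

definition tlift :: "('a::cvec \<Rightarrow> 'b::cvec \<Rightarrow> 'c::cvec) \<Rightarrow> ('a, 'b) tensor \<Rightarrow> 'c" where
  "tlift f t = free_extend (\<lambda>(a, b). f a b) (rep_tensor t)"

lemma free_extend_superset:
  "finite S \<Longrightarrow> Poly_Mapping.keys p \<subseteq> S \<Longrightarrow> free_extend f p = (\<Sum>x\<in>S. cscale (Poly_Mapping.lookup p x) (f x))"
  unfolding free_extend_def
  by (rule sum.mono_neutral_left) (auto simp: in_keys_iff)

lemma free_extend_add: "free_extend f (p + q) = free_extend f p + free_extend f q"
proof -
  have "Poly_Mapping.keys (p + q) \<subseteq> Poly_Mapping.keys p \<union> Poly_Mapping.keys q" by (rule keys_add)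
  then show ?thesis
    by (simp add: free_extend_superset[of "Poly_Mapping.keys p \<union> Poly_Mapping.keys q"] lookup_add cscale_add_left sum.distrib)
qed

lemma free_extend_scale: "free_extend f (fscale c p) = cscale c (free_extend f p)"
proof -
  have "Poly_Mapping.keys (fscale c p) \<subseteq> Poly_Mapping.keys p" by (auto simp: in_keys_iff lookup_fscale)
  then show ?thesis
    by (simp add: free_extend_superset[of "Poly_Mapping.keys p"] lookup_fscale cv.scale_sum_right cscale_cscale)
qed

lemma free_extend_diff: "free_extend f (p - q) = free_extend f p - free_extend f q"
  by (metis add_diff_cancel_right' diff_add_cancel free_extend_add)

lemma free_extend_gen: "free_extend f (gen x) = f x"
  by (simp add: free_extend_def cscale_one)

lemma free_extend_relations:
  assumes f: "cbilinear f" and p: "p \<in> free.span tensor_relations"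
  shows "free_extend (\<lambda>(a, b). f a b) p = 0"
  using p
proof (induct rule: free.span_induct_alt)
  case base
  then show ?case by (simp add: free_extend_def)
next
  case (step c x y)
  have "free_extend (\<lambda>(a, b). f a b) x = 0"
    using step(1) unfolding tensor_relations_def
    by (auto simp: free_extend_diff free_extend_gen free_extend_scale cbilinearD[OF f])
  then show ?case by (simp add: free_extend_add free_extend_scale step(2))
qed

lemma tlift_abs:
  assumes f: "cbilinear f"
  shows "tlift f (abs_tensor p) = free_extend (\<lambda>(a, b). f a b) p"
proof -
  have "tensor_eq (rep_tensor (abs_tensor p)) p"
    by (simp add: tensor.abs_eq_iff[symmetric] Quotient3_abs_rep[OF Quotient3_tensor])
  then have "free_extend (\<lambda>(a, b). f a b) (rep_tensor (abs_tensor p) - p) = 0"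
    unfolding tensor_eq_def by (rule free_extend_relations[OF f])
  then show ?thesis by (simp add: tlift_def free_extend_diff)
qed

lemma abs_tensor_cases:
  obtains p where "t = abs_tensor p"
  by (rule that[OF Quotient3_abs_rep[OF Quotient3_tensor, symmetric]])

lemma tlift_tens: "cbilinear f \<Longrightarrow> tlift f (a \<otimes> b) = f a b"
  by (simp add: tens.abs_eq tlift_abs free_extend_gen)

lemma clinear_tlift:
  assumes f: "cbilinear f"
  shows "clinear (tlift f)"
  unfolding clinear_iff
proof safe
  fix s t :: "('a, 'b) tensor" and c
  show "tlift f (s + t) = tlift f s + tlift f t"
    by (cases s rule: abs_tensor_cases, cases t rule: abs_tensor_cases) (simp add: plus_tensor.abs_eq tlift_abs[OF f] free_extend_add)
  show "tlift f (cscale c t) = cscale c (tlift f t)"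
    by (cases t rule: abs_tensor_cases) (simp add: cscale_tensor.abs_eq tlift_abs[OF f] free_extend_scale)
qed

lemma abs_tensor_free_extend:
  fixes p :: "('a::cvec \<times> 'b::cvec) \<Rightarrow>\<^sub>0 complex"
  shows "abs_tensor p = free_extend (\<lambda>(a, b). a \<otimes> b) p"
proof -
  have *: "abs_tensor (\<Sum>x\<in>S. fscale (Poly_Mapping.lookup p x) (gen x))
      = (\<Sum>x\<in>S. cscale (Poly_Mapping.lookup p x) (case x of (a, b) \<Rightarrow> a \<otimes> b))" if "finite S" for S
    using that
  proof (induct S rule: finite_induct)
    case empty
    then show ?case by (simp add: zero_tensor.abs_eq)
  next
    case (insert x S)
    have "abs_tensor (fscale (Poly_Mapping.lookup p x) (gen x))
        = cscale (Poly_Mapping.lookup p x) (case x of (a, b) \<Rightarrow> a \<otimes> b)"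
      by (cases x) (simp add: cscale_tensor.abs_eq tens.abs_eq)
    then show ?case
      unfolding sum.insert[OF insert(1,2)] plus_tensor.abs_eq[symmetric] insert(3) by simp
  qed
  have p: "p = (\<Sum>x\<in>Poly_Mapping.keys p. fscale (Poly_Mapping.lookup p x) (gen x))"
  proof (rule poly_mapping_eqI)
    fix k
    have "Poly_Mapping.lookup (\<Sum>x\<in>Poly_Mapping.keys p. fscale (Poly_Mapping.lookup p x) (gen x)) k
        = (\<Sum>x\<in>Poly_Mapping.keys p. if x = k then Poly_Mapping.lookup p x else 0)"
      unfolding lookup_sum lookup_fscale lookup_single by (rule sum.cong) (auto simp: when_def)
    also have "\<dots> = Poly_Mapping.lookup p k"
      by (simp add: sum.delta in_keys_iff)
    finally show "Poly_Mapping.lookup p k = Poly_Mapping.lookup (\<Sum>x\<in>Poly_Mapping.keys p. fscale (Poly_Mapping.lookup p x) (gen x)) k"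
      by (rule sym)
  qed
  show ?thesis
    unfolding free_extend_def *[OF finite_keys, symmetric] by (rule arg_cong[OF p])
qed

lemma tensor_induct [case_names zero add]:
  assumes "P 0" and "\<And>a b t. P t \<Longrightarrow> P (a \<otimes> b + t)"
  shows "P t"
proof (cases t rule: abs_tensor_cases)
  case (1 p)
  have "P (\<Sum>x\<in>S. cscale (Poly_Mapping.lookup p x) (case x of (a, b) \<Rightarrow> a \<otimes> b))" if "finite S" for S
    using that
  proof (induct S rule: finite_induct)
    case empty
    then show ?case using assms(1) by simp
  next
    case (insert x S)
    obtain a b where x: "x = (a, b)" by (cases x)
    have "cscale (Poly_Mapping.lookup p x) (a \<otimes> b) = cscale (Poly_Mapping.lookup p x) a \<otimes> b"
      by (simp add: cbilinearD[OF cbilinear_tens])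
    then show ?case using insert assms(2) by (simp add: x)
  qed
  then show ?thesis by (simp add: 1 abs_tensor_free_extend free_extend_def)
qed

instantiation tensor :: (cdmod, cdmod) cdmod
begin
definition der_tensor :: "('a, 'b) tensor \<Rightarrow> ('a, 'b) tensor" where
  "der_tensor = tlift (\<lambda>a b. der a \<otimes> b + a \<otimes> der b)"
instance
proof
  have "cbilinear (\<lambda>(a::'a) (b::'b). der a \<otimes> b + a \<otimes> der b)"
    by (rule cbilinearI)
      (simp_all add: der_add der_cscale cbilinearD[OF cbilinear_tens] cscale_add_right)
  note * = clinear_tlift[OF this]
  show "der (x + y) = der x + der y" "der (cscale c x) = cscale c (der x)"
    for x y :: "('a, 'b) tensor" and c
    by (simp_all add: der_tensor_def clinear_add[OF *] clinear_cscale[OF *])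
qed
end

definition tmap :: "('a::cvec \<Rightarrow> 'c::cvec) \<Rightarrow> ('b::cvec \<Rightarrow> 'd::cvec) \<Rightarrow> ('a, 'b) tensor \<Rightarrow> ('c, 'd) tensor" where
  "tmap f g = tlift (\<lambda>a b. f a \<otimes> g b)"

definition tswap :: "('a::cvec, 'b::cvec) tensor \<Rightarrow> ('b, 'a) tensor" where
  "tswap = tlift (\<lambda>a b. b \<otimes> a)"

definition tassoc :: "(('a::cvec, 'b::cvec) tensor, 'c::cvec) tensor \<Rightarrow> ('a, ('b, 'c) tensor) tensor" where
  "tassoc = tlift (\<lambda>t c. tlift (\<lambda>a b. a \<otimes> (b \<otimes> c)) t)"

section \<open>Conformal linear maps\<close>

definition conf_linear :: "('u::cdmod \<Rightarrow> 'v::cdmod poly) \<Rightarrow> bool" where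
  "conf_linear T \<longleftrightarrow> clinear T \<and>
     (\<forall>u \<kappa>. pev (T (der u)) \<kappa> = der (pev (T u) \<kappa>) + cscale \<kappa> (pev (T u) \<kappa>))"

typedef (overloaded) ('u, 'v) chom = "{T :: 'u::cdmod \<Rightarrow> 'v::cdmod poly. conf_linear T}"
  morphisms capp Abs_chom
  by (rule exI[of _ "\<lambda>_. 0"])
    (simp add: conf_linear_def clinear_iff pev_0 clinear_0[OF clinear_der])

setup_lifting type_definition_chom

notation capp (infixl "\<cdot>" 75)

type_synonym 'a cend = "('a, 'a) chom"
type_synonym 'a cdual = "('a, complex) chom"

lemma capp_conf_linear: "conf_linear (capp T)"
  using capp by auto

lemma capp_add: "T \<cdot> (x + y) = T \<cdot> x + T \<cdot> y" and capp_cscale: "T \<cdot> (cscale c x) = cscale c (T \<cdot> x)"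
  using capp_conf_linear[of T] by (auto simp: conf_linear_def clinear_iff)

instantiation chom :: (cdmod, cdmod) cdmod
begin

lift_definition zero_chom :: "('a, 'b) chom" is "\<lambda>_. 0"
  by (simp add: conf_linear_def clinear_iff pev_0 clinear_0[OF clinear_der])

lift_definition plus_chom :: "('a, 'b) chom \<Rightarrow> ('a, 'b) chom \<Rightarrow> ('a, 'b) chom"
  is "\<lambda>S T u. S u + T u"
  by (auto simp: conf_linear_def clinear_iff clinear_add[OF clinear_pev] der_add cscale_add_right)

lift_definition uminus_chom :: "('a, 'b) chom \<Rightarrow> ('a, 'b) chom"
  is "\<lambda>T u. - T u"
  by (auto simp: conf_linear_def clinear_iff clinear_minus[OF clinear_pev]
      clinear_minus[OF clinear_der])

lift_definition minus_chom :: "('a, 'b) chom \<Rightarrow> ('a, 'b) chom \<Rightarrow> ('a, 'b) chom"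
  is "\<lambda>S T u. S u - T u"
  by (auto simp: conf_linear_def clinear_iff clinear_diff[OF clinear_pev]
      clinear_diff[OF clinear_der] cv.scale_right_diff_distrib)

lift_definition cscale_chom :: "complex \<Rightarrow> ('a, 'b) chom \<Rightarrow> ('a, 'b) chom"
  is "\<lambda>c T u. cscale c (T u)"
  by (auto simp: conf_linear_def clinear_iff clinear_cscale[OF clinear_pev] der_cscale
      cscale_add_right cscale_cscale mult.commute)

text \<open>\<open>(\<partial>T)\<^sub>\<kappa> = -\<kappa> T\<^sub>\<kappa>\<close>\<close>
lift_definition der_chom :: "('a, 'b) chom \<Rightarrow> ('a, 'b) chom"
  is "\<lambda>T u. - pCons 0 (T u)"
proof -
  fix T :: "'a \<Rightarrow> 'b poly"
  assume T: "conf_linear T"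
  have "pCons 0 (- cscale c p) = cscale c (pCons 0 (- p))" for c and p :: "'b poly"
    by (simp add: poly_eq_iff coeff_pCons coeff_cscale split: nat.splits)
  with T show "conf_linear (\<lambda>u. - pCons 0 (T u))"
    by (auto simp: conf_linear_def clinear_iff clinear_minus[OF clinear_pev] pev_pCons
        clinear_minus[OF clinear_der] der_cscale cscale_add_right cscale_cscale
        cv.scale_right_diff_distrib)
qed

instance
proof
  fix x y z :: "('a, 'b) chom" and c d :: complex
  have pCons_cscale: "pCons 0 (- cscale c p) = cscale c (pCons 0 (- p))"
    for c and p :: "'b poly"
    by (simp add: poly_eq_iff coeff_pCons coeff_cscale split: nat.splits)
  show "x + y + z = x + (y + z)" by transfer (simp add: add.assoc)
  show "x + y = y + x" by transfer (simp add: add.commute)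
  show "0 + x = x" by transfer simp
  show "- x + x = 0" by transfer simp
  show "x - y = x + - y" by transfer simp
  show "cscale c (x + y) = cscale c x + cscale c y" by transfer (simp add: cscale_add_right)
  show "cscale (c + d) x = cscale c x + cscale d x" by transfer (simp add: cscale_add_left)
  show "cscale c (cscale d x) = cscale (c * d) x" by transfer (simp add: cscale_cscale)
  show "cscale 1 x = x" by transfer (simp add: cscale_one)
  show "der (x + y) = der x + der y" by transfer (auto simp: fun_eq_iff)
  show "der (cscale c x) = cscale c (der x)" by transfer (simp add: pCons_cscale)
qed

end

text \<open>\<open>T \<otimes> I\<close> and \<open>I \<otimes> T\<close>, with values in \<open>(V \<otimes> W)[\<nu>]\<close>\<close>

definition tensor_left :: "('u::cdmod, 'v::cdmod) chom \<Rightarrow> ('u, 'w::cdmod) tensor \<Rightarrow> ('v, 'w) tensor poly" where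
  "tensor_left T = tlift (\<lambda>x y. map_poly (\<lambda>z. z \<otimes> y) (T \<cdot> x))"

definition tensor_right :: "('u::cdmod, 'v::cdmod) chom \<Rightarrow> ('w::cdmod, 'u) tensor \<Rightarrow> ('w, 'v) tensor poly" where
  "tensor_right T = tlift (\<lambda>x y. map_poly (\<lambda>z. x \<otimes> z) (T \<cdot> y))"

section \<open>Associative conformal algebras\<close>

type_synonym 'a lambda_product = "'a \<Rightarrow> 'a \<Rightarrow> 'a poly"

definition assoc_conformal_algebra :: "'a::cdmod lambda_product \<Rightarrow> bool" where
  "assoc_conformal_algebra m \<longleftrightarrow> cbilinear m \<and>
     (\<forall>a b \<kappa>. pev (m (der a) b) \<kappa> = - cscale \<kappa> (pev (m a b) \<kappa>)) \<and>
     (\<forall>a b \<kappa>. pev (m a (der b)) \<kappa> = der (pev (m a b) \<kappa>) + cscale \<kappa> (pev (m a b) \<kappa>)) \<and>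
     (\<forall>a b c \<kappa> \<mu>. pev (m (pev (m a b) \<kappa>) c) (\<kappa> + \<mu>) = pev (m a (pev (m b c) \<mu>)) \<kappa>)"

definition L_op :: "'a::cdmod lambda_product \<Rightarrow> 'a \<Rightarrow> 'a cend" where
  "L_op m a = Abs_chom (\<lambda>b. m a b)"

definition R_op :: "'a::cdmod lambda_product \<Rightarrow> 'a \<Rightarrow> 'a cend" where
  "R_op m a = Abs_chom (\<lambda>b. pflip (m b a))"

lemma capp_L_op:
  assumes "assoc_conformal_algebra m"
  shows "L_op m a \<cdot> b = m a b"
proof -
  have "conf_linear (m a)"
    using assms by (simp add: assoc_conformal_algebra_def conf_linear_def cbilinear_def)
  then show ?thesis by (simp add: L_op_def Abs_chom_inverse)
qed

lemma capp_R_op: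
  assumes m: "assoc_conformal_algebra m"
  shows "R_op m a \<cdot> b = pflip (m b a)"
proof -
  have bil: "cbilinear m" using m by (simp add: assoc_conformal_algebra_def)
  have lin: "clinear (\<lambda>b. pflip (m b a))"
    unfolding clinear_iff
  proof safe
    fix x y c
    show "pflip (m (x + y) a) = pflip (m x a) + pflip (m y a)"
      by (rule pev_inject) (simp add: pev_pflip clinear_add[OF clinear_pev] clinear_add[OF clinear_pevd] cbilinearD[OF bil])
    show "pflip (m (cscale c x) a) = cscale c (pflip (m x a))"
      by (rule pev_inject) (simp add: pev_pflip clinear_cscale[OF clinear_pev] clinear_cscale[OF clinear_pevd] cbilinearD[OF bil])
  qed
  have der: "m (der b) a = - pCons 0 (m b a)" for b
    by (rule pev_inject)
      (use m in \<open>simp add: assoc_conformal_algebra_def clinear_minus[OF clinear_pev] pev_pCons\<close>)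
  have "conf_linear (\<lambda>b. pflip (m b a))"
    unfolding conf_linear_def
    by (simp add: lin der pev_pflip clinear_minus[OF clinear_pevd] pevd_pCons
        clinear_minus[OF clinear_der])
  then show ?thesis by (simp add: R_op_def Abs_chom_inverse)
qed

definition bimodule :: "'a::cdmod lambda_product \<Rightarrow> ('a \<Rightarrow> 'm::cdmod cend) \<Rightarrow> ('a \<Rightarrow> 'm cend) \<Rightarrow> bool" where
  "bimodule m l r \<longleftrightarrow> cd_hom l \<and> cd_hom r \<and>
     (\<forall>a b v \<kappa> \<mu>. pev (l (pev (m a b) \<kappa>) \<cdot> v) (\<kappa> + \<mu>) = pev (l a \<cdot> pev (l b \<cdot> v) \<mu>) \<kappa>) \<and>
     (\<forall>a b v \<kappa> \<mu>. pevd (r b \<cdot> pevd (r a \<cdot> v) \<kappa>) (\<kappa> + \<mu>) = pevd (r (pev (m a b) \<mu>) \<cdot> v) \<kappa>) \<and>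
     (\<forall>a b v \<kappa> \<mu>. pev (l a \<cdot> pevd (r b \<cdot> v) \<mu>) \<kappa> = pevd (r b \<cdot> pev (l a \<cdot> v) \<kappa>) (\<kappa> + \<mu>))"

definition matched_pair ::
    "'a::cdmod lambda_product \<Rightarrow> 'b::cdmod lambda_product \<Rightarrow>
     ('a \<Rightarrow> 'b cend) \<Rightarrow> ('a \<Rightarrow> 'b cend) \<Rightarrow> ('b \<Rightarrow> 'a cend) \<Rightarrow> ('b \<Rightarrow> 'a cend) \<Rightarrow> bool" where
  "matched_pair mA mB lA rA lB rB \<longleftrightarrow>
     assoc_conformal_algebra mA \<and> assoc_conformal_algebra mB \<and>
     bimodule mA lA rA \<and> bimodule mB lB rB \<and>
     (\<forall>a x y \<kappa> \<mu>.
        pev (lA a \<cdot> pev (mB x y) \<mu>) \<kappa> =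
        pev (mB (pev (lA a \<cdot> x) \<kappa>) y) (\<kappa> + \<mu>) + pev (lA (pevd (rB x \<cdot> a) \<kappa>) \<cdot> y) (\<kappa> + \<mu>)) \<and>
     (\<forall>a b x \<kappa> \<mu>.
        pevd (rB x \<cdot> pev (mA a b) \<kappa>) (\<kappa> + \<mu>) =
        pev (mA a (pevd (rB x \<cdot> b) \<mu>)) \<kappa> + pevd (rB (pev (lA b \<cdot> x) \<mu>) \<cdot> a) \<kappa>) \<and>
     (\<forall>a b x \<kappa> \<mu>.
        pev (lB x \<cdot> pev (mA a b) \<mu>) \<kappa> =
        pev (mA (pev (lB x \<cdot> a) \<kappa>) b) (\<kappa> + \<mu>) + pev (lB (pevd (rA a \<cdot> x) \<kappa>) \<cdot> b) (\<kappa> + \<mu>)) \<and>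
     (\<forall>a x y \<kappa> \<mu>.
        pevd (rA (pev (lB y \<cdot> a) \<mu>) \<cdot> x) \<kappa> + pev (mB x (pevd (rA a \<cdot> y) \<mu>)) \<kappa> =
        pevd (rA a \<cdot> pev (mB x y) \<kappa>) (\<kappa> + \<mu>)) \<and>
     (\<forall>a x y \<kappa> \<mu>.
        pevd (rA (pevd (rB y \<cdot> a) \<mu>) \<cdot> x) \<kappa> + pev (mB x (pev (lA a \<cdot> y) \<mu>)) \<kappa> =
        pev (lA (pev (lB x \<cdot> a) \<kappa>) \<cdot> y) (\<kappa> + \<mu>) + pev (mB (pevd (rA a \<cdot> x) \<kappa>) y) (\<kappa> + \<mu>)) \<and>
     (\<forall>a b x \<kappa> \<mu>.
        pev (mA a (pev (lB x \<cdot> b) \<mu>)) \<kappa> + pevd (rB (pevd (rA b \<cdot> x) \<mu>) \<cdot> a) \<kappa> =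
        pev (mA (pevd (rB x \<cdot> a) \<kappa>) b) (\<kappa> + \<mu>) + pev (lB (pev (lA a \<cdot> x) \<kappa>) \<cdot> b) (\<kappa> + \<mu>))"

section \<open>ASI conformal bialgebras\<close>

definition assoc_conformal_coalgebra :: "('a::cdmod \<Rightarrow> ('a, 'a) tensor) \<Rightarrow> bool" where
  "assoc_conformal_coalgebra \<Delta> \<longleftrightarrow> cd_hom \<Delta> \<and>
     (\<forall>a. tmap id \<Delta> (\<Delta> a) = tassoc (tmap \<Delta> id (\<Delta> a)))"

definition ASI_conformal_bialgebra :: "'a::cdmod lambda_product \<Rightarrow> ('a \<Rightarrow> ('a, 'a) tensor) \<Rightarrow> bool" where
  "ASI_conformal_bialgebra m \<Delta> \<longleftrightarrow>
     assoc_conformal_algebra m \<and> assoc_conformal_coalgebra \<Delta> \<and>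
     (\<forall>a b \<kappa>. \<Delta> (pev (m a b) \<kappa>) =
        pev (tensor_right (L_op m a) (\<Delta> b)) \<kappa> + pevd (tensor_left (R_op m b) (\<Delta> a)) \<kappa>) \<and>
     (\<forall>a b \<kappa>.
        (pevd (tensor_left (L_op m b) (\<Delta> a)) \<kappa> - pevd (tensor_right (R_op m b) (\<Delta> a)) \<kappa>) +
        tswap (pev (tensor_left (L_op m a) (\<Delta> b)) \<kappa> - pev (tensor_right (R_op m a) (\<Delta> b)) \<kappa>) = 0)"

section \<open>Conformal duals\<close>

text \<open>
  The following maps are polynomial in \<open>\<kappa>\<close> with coefficients in a conformal dual (respectively
  in \<open>A\<close>), and thus exist, because \<open>A\<close> is finite (respectively finite and free);
  \<open>THE\<close> picks the polynomial determined by the defining equation.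
\<close>

text \<open>The \<open>\<kappa>\<close>-product on the conformal dual: \<open>(f\<^sub>\<kappa> g)\<^sub>\<mu> (a) = \<Sum> f\<^sub>\<kappa> (a\<^sub>1) g\<^bsub>\<mu>-\<kappa>\<^esub> (a\<^sub>2)\<close>\<close>

definition dual_product :: "('a::cdmod \<Rightarrow> ('a, 'a) tensor) \<Rightarrow> 'a cdual lambda_product" where
  "dual_product \<Delta> f g =
     (THE p. \<forall>\<kappa> \<mu> a. pev (pev p \<kappa> \<cdot> a) \<mu> =
        tlift (\<lambda>x y. pev (f \<cdot> x) \<kappa> * pev (g \<cdot> y) (\<mu> - \<kappa>)) (\<Delta> a))"

text \<open>\<open>(T\<^sup>*\<^sub>\<kappa> f)\<^sub>\<mu> b = f\<^bsub>\<mu>-\<kappa>\<^esub> (T\<^sub>\<kappa> b)\<close>\<close>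

definition cend_dual :: "'a::cdmod cend \<Rightarrow> 'a cdual cend" where
  "cend_dual T = Abs_chom (\<lambda>f. THE p. \<forall>\<kappa> \<mu> b.
     pev (pev p \<kappa> \<cdot> b) \<mu> = pev (f \<cdot> pev (T \<cdot> b) \<kappa>) (\<mu> - \<kappa>))"

text \<open>
  The dual of an endomorphism \<open>S\<close> of \<open>A\<^sup>*\<close>, as an endomorphism of \<open>A\<close> under the identification
  \<open>A \<cong> A\<^sup>*\<^sup>*\<close>, \<open>a\<^sub>\<mu> (h) = h\<^bsub>-\<mu>\<^esub> (a)\<close>: \<open>h\<^bsub>-\<mu>\<^esub> (S\<^sup>*\<^sub>\<kappa> a) = (S\<^sub>\<kappa> h)\<^bsub>\<kappa>-\<mu>\<^esub> (a)\<close>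
\<close>

definition cend_predual :: "'a::cdmod cdual cend \<Rightarrow> 'a cend" where
  "cend_predual S = Abs_chom (\<lambda>a. THE p. \<forall>\<kappa> \<mu> h.
     pev (h \<cdot> pev p \<kappa>) (- \<mu>) = pev (pev (S \<cdot> h) \<kappa> \<cdot> a) (\<kappa> - \<mu>))"

section \<open>Frobenius conformal algebras and double constructions\<close>

definition conformal_bilinear_form :: "('v::cdmod \<Rightarrow> 'v \<Rightarrow> complex poly) \<Rightarrow> bool" where
  "conformal_bilinear_form \<beta> \<longleftrightarrow> cbilinear \<beta> \<and>
     (\<forall>a b \<kappa>. poly (\<beta> (der a) b) \<kappa> = - \<kappa> * poly (\<beta> a b) \<kappa>) \<and>
     (\<forall>a b \<kappa>. poly (\<beta> a (der b)) \<kappa> = \<kappa> * poly (\<beta> a b) \<kappa>)"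

definition nondegenerate :: "('v::cdmod \<Rightarrow> 'v \<Rightarrow> complex poly) \<Rightarrow> bool" where
  "nondegenerate \<beta> \<longleftrightarrow>
     cd_hom (\<lambda>v. Abs_chom (\<beta> v) :: 'v cdual) \<and> bij (\<lambda>v. Abs_chom (\<beta> v) :: 'v cdual)"

text \<open>\<open>b\<^bsub>\<mu>-\<partial>\<^esub>c\<close> is \<open>pevd (m b c) (- \<mu>)\<close>.\<close>

definition Frobenius_conformal_algebra ::
    "'v::cdmod lambda_product \<Rightarrow> ('v \<Rightarrow> 'v \<Rightarrow> complex poly) \<Rightarrow> bool" where
  "Frobenius_conformal_algebra m \<beta> \<longleftrightarrow>
     assoc_conformal_algebra m \<and> conformal_bilinear_form \<beta> \<and> nondegenerate \<beta> \<and>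
     (\<forall>a b c \<kappa> \<mu>. poly (\<beta> (pev (m a b) \<kappa>) c) \<mu> = poly (\<beta> a (pevd (m b c) (- \<mu>))) \<kappa>)"

text \<open>\<open>\<langle>a + f, b + g\<rangle>\<^sub>\<kappa> = f\<^sub>\<kappa> (b) + g\<^bsub>-\<kappa>\<^esub> (a)\<close>\<close>

definition double_form :: "'b::cdmod \<times> 'b cdual \<Rightarrow> 'b \<times> 'b cdual \<Rightarrow> complex poly" where
  "double_form x y = snd x \<cdot> fst y + pcompose (snd y \<cdot> fst x) [:0, -1:]"

definition double_construction ::
    "'b::cdmod lambda_product \<Rightarrow> 'b cdual lambda_product \<Rightarrow> ('b \<times> 'b cdual) lambda_product \<Rightarrow> bool" where
  "double_construction m m' M \<longleftrightarrow>
     Frobenius_conformal_algebra M double_form \<and>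
     (\<forall>a b. M (a, 0) (b, 0) = map_poly (\<lambda>c. (c, 0)) (m a b)) \<and>
     (\<forall>f g. M (0, f) (0, g) = map_poly (\<lambda>h. (0, h)) (m' f g))"

end

theory Submission
  imports Defs
begin

text \<open>
  On \<open>A \<oplus> A\<^sup>*\<close> there is exactly one product that extends the products of \<open>A\<close> and \<open>A\<^sup>*\<close> and for
  which the natural form is invariant: the bowtie product of the dual actions. A double construction
  exists iff this product is associative, and the components of associativity on mixed triples are
  the axioms of a matched pair. On the other hand, with an invariant form the associator, paired with
  a fourth argument, becomes the defect of a cyclic symmetry, so that only the cyclic words
  \<open>AAA\<^sup>*A\<^sup>*\<close> and \<open>AA\<^sup>*AA\<^sup>*\<close> matter. Evaluated through \<open>\<Delta>\<close>, they are the two ASI conditions paired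
  with elements of \<open>A\<^sup>* \<otimes> A\<^sup>*\<close>, and these pairings separate the points of \<open>A \<otimes> A\<close> because \<open>A\<close> is
  finite and free.
\<close>

section \<open>Evaluation under linear functionals\<close>

text \<open>The awkward feature of the definitions is the substitution of
  \<open>- \<kappa> - der\<close>, with \<open>der\<close> acting on coefficients, inside nested
  products. It disappears under maps on which \<open>der\<close> acts as a scalar \<open>c\<close>:
  there it becomes evaluation at \<open>- \<kappa> - c\<close>. Conformal functionals at a fixed
  parameter, their tensor products, the form with its first argument and parameter fixed, and
  evaluation of dual elements at a point are all of this kind. Tested by them, every identity
  becomes one between complex numbers with explicit spectral parameters. The second obstacle is that
  the dual product and the dual actions are chosen by \<open>THE\<close>, so nothing is known about
  them until polynomials with the required values are exhibited. The values are shown to be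
  polynomial in the parameter, and a finite \<open>pscale\<close>-basis with its dual basis turns
  them into elements of the dual or of the module. Coassociativity is not a separate condition on
  \<open>\<Delta>\<close>: it is the transpose of associativity of the dual product.\<close>

lemma functional_pevd:
  assumes "clinear \<phi>" "\<And>x. \<phi> (der x) = cscale c (\<phi> x)"
  shows "\<phi> (pevd p \<kappa>) = \<phi> (pev p (- \<kappa> - c))"
proof (induct p)
  case (pCons v p)
  have "\<phi> (pevd (pCons v p) \<kappa>) = \<phi> v - cscale \<kappa> (\<phi> (pevd p \<kappa>)) - cscale c (\<phi> (pevd p \<kappa>))"
    using assms by (simp add: pevd_pCons clinear_diff clinear_cscale)
  also have "\<dots> = \<phi> v + cscale (- \<kappa> - c) (\<phi> (pevd p \<kappa>))"
    by (simp add: cv.scale_left_diff_distrib)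
  finally show ?case
    using assms pCons by (simp add: pev_pCons clinear_add clinear_cscale)
qed (simp add: pevd_0 pev_0)

lemma cscale_complex: "cscale c x = c * x" for x :: complex
  by (simp add: cscale_complex_def)

lemma chom_eqI: "(\<And>u. S \<cdot> u = T \<cdot> u) \<Longrightarrow> S = T"
  by (meson capp_inject ext)

lemma cdual_eqI: "(\<And>a \<kappa>. poly (f \<cdot> a) \<kappa> = poly (g \<cdot> a) \<kappa>) \<Longrightarrow> f = g" for f :: "'a::cdmod cdual"
  using poly_eq_poly_eq_iff by (intro chom_eqI) blast

lemma pev_chom_der: "pev (T \<cdot> der u) \<kappa> = der (pev (T \<cdot> u) \<kappa>) + cscale \<kappa> (pev (T \<cdot> u) \<kappa>)"
  using capp_conf_linear[of T] by (simp add: conf_linear_def)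

lemma pev_der_chom: "pev (der T \<cdot> u) \<kappa> = - cscale \<kappa> (pev (T \<cdot> u) \<kappa>)"
  by (simp add: der_chom.rep_eq clinear_minus[OF clinear_pev] pev_pCons)

lemma poly_cdual_der: "poly (f \<cdot> der a) \<kappa> = \<kappa> * poly (f \<cdot> a) \<kappa>" for f :: "'a::cdmod cdual"
  using pev_chom_der[of f a \<kappa>] by (simp add: pev_complex der_complex_def cscale_complex)

lemma poly_der_cdual: "poly (der f \<cdot> a) \<kappa> = - \<kappa> * poly (f \<cdot> a) \<kappa>" for f :: "'a::cdmod cdual"
  using pev_der_chom[of f a \<kappa>] by (simp add: pev_complex cscale_complex)

lemma poly_ext: "(\<And>\<kappa>. poly p \<kappa> = poly q \<kappa>) \<Longrightarrow> p = q" for p q :: "complex poly"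
  using poly_eq_poly_eq_iff by blast

lemma poly_cscale: "poly (cscale c p) \<kappa> = c * poly p \<kappa>" for p :: "complex poly"
  by (metis clinear_cscale[OF clinear_pev] pev_complex cscale_complex)

lemma clinear_capp: "clinear (\<lambda>u. T \<cdot> u)"
  by (simp add: clinear_iff capp_add capp_cscale)

lemma clinear_capp_left: "clinear (\<lambda>T. T \<cdot> u)"
  by (simp add: clinear_iff plus_chom.rep_eq cscale_chom.rep_eq)

lemma clinear_compose: "clinear f \<Longrightarrow> clinear g \<Longrightarrow> clinear (\<lambda>x. f (g x))"
  by (simp add: clinear_iff)

lemma clinear_poly: "clinear (\<lambda>p :: complex poly. poly p \<kappa>)"
  by (simp add: clinear_iff poly_cscale cscale_complex)

lemmas clinear_cdual = clinear_compose[OF clinear_poly clinear_capp]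
lemmas clinear_cdual_left = clinear_compose[OF clinear_poly clinear_capp_left]

lemma cdual_arg_pevd: "poly (f \<cdot> pevd p \<nu>) \<kappa> = poly (f \<cdot> pev p (- \<nu> - \<kappa>)) \<kappa>"
  for f :: "'a::cdmod cdual"
  by (rule functional_pevd[OF clinear_cdual[of f \<kappa>]])
    (simp add: poly_cdual_der cscale_complex)

lemma cdual_pevd: "poly (pevd p \<nu> \<cdot> a) \<kappa> = poly (pev p (\<kappa> - \<nu>) \<cdot> a) \<kappa>"
  for p :: "'a::cdmod cdual poly"
  using functional_pevd[OF clinear_cdual_left[of a \<kappa>], of "- \<kappa>" p \<nu>]
  by (simp add: poly_der_cdual cscale_complex)

lemma conf_linear_cdual:
  "conf_linear G \<longleftrightarrow> clinear G \<and> (\<forall>u \<kappa>. poly (G (der u)) \<kappa> = \<kappa> * poly (G u) \<kappa>)"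
  for G :: "'a::cdmod \<Rightarrow> complex poly"
  by (simp add: conf_linear_def pev_complex der_complex_def cscale_complex)

text \<open>For complex polynomial values, conformal linearity says that \<open>der\<close> becomes
  multiplication by the polynomial variable, so \<open>G\<close> is a
  \<open>\<complex>[\<partial>]\<close>-linear map into the polynomial ring acting on itself. This
  makes coordinates over a basis usable for conformal functionals.\<close>

lemma conf_linear_pscale:
  fixes G :: "'a::cdmod \<Rightarrow> complex poly"
  assumes "conf_linear G"
  shows "G (pscale q x) = q * G x"
proof -
  have "poly (G (pscale q x)) \<kappa> = poly (q * G x) \<kappa>" for \<kappa>
    using assms unfolding conf_linear_cdual
    by (induct q)
      (simp_all add: pscale_0 pscale_pCons clinear_0 clinear_add clinear_cscale poly_cscale algebra_simps)
  then show ?thesis using poly_eq_poly_eq_iff by blast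
qed

section \<open>Polynomial functions\<close>

text \<open>Phrases the existence of a polynomial through its values, so that the polynomials
  demanded by the \<open>THE\<close> definitions can be assembled from closure properties instead of
  coefficients.\<close>

definition polyfun :: "(complex \<Rightarrow> 'v::cvec) \<Rightarrow> bool" where
  "polyfun F \<longleftrightarrow> (\<exists>p. \<forall>\<kappa>. pev p \<kappa> = F \<kappa>)"

lemma polyfun_const: "polyfun (\<lambda>\<kappa>. v)"
  unfolding polyfun_def by (rule exI[of _ "[:v:]"]) (simp add: pev_pCons pev_0)

lemma polyfun_add: "polyfun F \<Longrightarrow> polyfun G \<Longrightarrow> polyfun (\<lambda>\<kappa>. F \<kappa> + G \<kappa>)"
  unfolding polyfun_def by (metis clinear_add[OF clinear_pev])

lemma polyfun_sum: "(\<And>i. i \<in> I \<Longrightarrow> polyfun (F i)) \<Longrightarrow> polyfun (\<lambda>\<kappa>. \<Sum>i\<in>I. F i \<kappa>)"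
  by (induct I rule: infinite_finite_induct) (auto intro: polyfun_const polyfun_add)

lemma polyfun_mult_var: "polyfun F \<Longrightarrow> polyfun (\<lambda>\<kappa>. cscale \<kappa> (F \<kappa>))"
  unfolding polyfun_def by (metis pev_pCons add_0)

lemma polyfun_linear:
  assumes "clinear f" "polyfun F"
  shows "polyfun (\<lambda>\<kappa>. f (F \<kappa>))"
  using assms unfolding polyfun_def by (metis pev_map_poly)

text \<open>The parameter occurs both in the operator and in its argument; Horner's scheme for
  \<open>p\<close> separates the two occurrences.\<close>

lemma polyfun_pev:
  assumes "\<And>\<kappa>. clinear (H \<kappa>)" "\<And>v. polyfun (\<lambda>\<kappa>. H \<kappa> v)"
  shows "polyfun (\<lambda>\<kappa>. H \<kappa> (pev p \<kappa>))"
proof (induct p)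
  case (pCons v p)
  show ?case
    unfolding pev_pCons clinear_add[OF assms(1)] clinear_cscale[OF assms(1)]
    by (intro polyfun_add polyfun_mult_var assms(2) pCons(2))
qed (simp add: assms(1) pev_0 clinear_0 polyfun_const)

lemma polyfun_cscale_poly: "polyfun (\<lambda>\<kappa>. cscale (poly q \<kappa>) v)"
proof (induct q)
  case (pCons c q)
  show ?case
    unfolding poly_pCons cscale_add_left cscale_cscale[symmetric]
    by (rule polyfun_add[OF polyfun_const polyfun_mult_var[OF pCons(2)]])
qed (simp add: polyfun_const)

lemma polyfun_mult_cscale:
  assumes "polyfun F"
  shows "polyfun (\<lambda>\<kappa>. cscale (poly q \<kappa>) (F \<kappa>))"
proof -
  obtain p where "\<And>\<kappa>. pev p \<kappa> = F \<kappa>" using assms by (auto simp: polyfun_def)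
  then show ?thesis
    using polyfun_pev[of "\<lambda>\<kappa>. cscale (poly q \<kappa>)" p]
    by (simp add: polyfun_cscale_poly clinear_cscale_fun)
qed

lemma cscale_poly_eq_smult: "cscale c p = smult c p" for p :: "complex poly"
  by (rule poly_eqI) (simp add: coeff_cscale cscale_complex)

lemma clinear_pmult: "clinear (\<lambda>q. r * q)" for r :: "complex poly"
  by (simp add: clinear_iff cscale_poly_eq_smult algebra_simps)

lemma clinear_pcompose: "clinear (\<lambda>q. pcompose q r)" for r :: "complex poly"
  by (simp add: clinear_iff pcompose_add cscale_poly_eq_smult pcompose_smult)

text \<open>Reading the values as polynomials in \<open>\<mu>\<close>, this presents
  \<open>q\<close> at \<open>\<mu> - \<kappa>\<close> (for \<open>s = - 1\<close>) and at
  \<open>\<kappa> + \<mu>\<close> (for \<open>s = 1\<close>) as a polynomial in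
  \<open>\<kappa>\<close> with coefficients in \<open>complex poly\<close>.\<close>

lemma polyfun_shift: "polyfun (\<lambda>\<kappa>. pcompose q [:s * \<kappa>, 1:])" for q :: "complex poly"
proof (induct q)
  case (pCons c q)
  have *: "pcompose (pCons c q) [:s * \<kappa>, 1:]
      = [:c:] + (cscale \<kappa> (smult s (pcompose q [:s * \<kappa>, 1:])) + [:0, 1:] * pcompose q [:s * \<kappa>, 1:])" for \<kappa>
    by (simp add: pcompose_pCons cscale_poly_eq_smult algebra_simps)
  have "polyfun (\<lambda>\<kappa>. smult s (pcompose q [:s * \<kappa>, 1:]))"
    using polyfun_linear[OF clinear_cscale_fun[of s] pCons(2)] by (simp add: cscale_poly_eq_smult)
  then show ?case
    unfolding * using pCons(2)
    by (intro polyfun_add polyfun_const polyfun_mult_var polyfun_linear[OF clinear_pmult])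
qed (simp add: polyfun_const)

lemma polyfun_shift_minus: "polyfun (\<lambda>\<kappa>. pcompose q [:- \<kappa>, 1:])" for q :: "complex poly"
  using polyfun_shift[of q "- 1"] by simp

lemma polyfun_shift_plus: "polyfun (\<lambda>\<kappa>. pcompose q [:\<kappa>, 1:])" for q :: "complex poly"
  using polyfun_shift[of q 1] by simp

lemma poly_pcompose_shift: "poly (pcompose q [:s, 1:]) \<mu> = poly q (s + \<mu>)" for q :: "complex poly"
  by (simp add: poly_pcompose)

section \<open>Tensors are determined by products of functionals\<close>

definition separating :: "('a::cvec \<Rightarrow> complex) set \<Rightarrow> bool" where
  "separating \<Phi> \<longleftrightarrow> (\<forall>\<phi>\<in>\<Phi>. clinear \<phi>) \<and> (\<forall>x. (\<forall>\<phi>\<in>\<Phi>. \<phi> x = 0) \<longrightarrow> x = 0)"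

lemma separating_eqI:
  assumes "separating \<Phi>" "\<And>\<phi>. \<phi> \<in> \<Phi> \<Longrightarrow> \<phi> x = \<phi> y"
  shows "x = y"
proof -
  have "\<phi> (x - y) = 0" if "\<phi> \<in> \<Phi>" for \<phi>
    using assms that clinear_diff[of \<phi> x y] by (simp add: separating_def)
  then have "x - y = 0"
    using assms(1) unfolding separating_def by blast
  then show ?thesis by simp
qed

lemma tens_zero_left: "0 \<otimes> b = 0"
  using cbilinearD(2)[OF cbilinear_tens, of 0 0 b] by simp

lemma tensor_linear_eqI:
  assumes "clinear F" "clinear G" "\<And>x y. F (x \<otimes> y) = G (x \<otimes> y)"
  shows "F t = G t"
  by (induct t rule: tensor_induct) (use assms in \<open>simp_all add: clinear_0 clinear_add\<close>)

lemma cbilinear_tensor_product: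
  fixes \<phi> :: "'a::cvec \<Rightarrow> complex" and \<psi> :: "'b::cvec \<Rightarrow> complex"
  assumes "clinear \<phi>" "clinear \<psi>"
  shows "cbilinear (\<lambda>x y. \<phi> x * \<psi> y)"
  using assms by (intro cbilinearI) (simp_all add: clinear_add clinear_cscale cscale_complex algebra_simps)

lemmas clinear_tlift_product = clinear_tlift[OF cbilinear_tensor_product]
lemmas tlift_product_tens = tlift_tens[OF cbilinear_tensor_product]

definition tensor_functionals ::
    "('a::cvec \<Rightarrow> complex) set \<Rightarrow> ('b::cvec \<Rightarrow> complex) set \<Rightarrow> (('a, 'b) tensor \<Rightarrow> complex) set" where
  "tensor_functionals \<Phi> \<Psi> = {tlift (\<lambda>x y. \<phi> x * \<psi> y) | \<phi> \<psi>. \<phi> \<in> \<Phi> \<and> \<psi> \<in> \<Psi>}"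

lemma cbilinear_coordinate:
  assumes "cv.independent B" "cv.span B = UNIV"
  shows "cbilinear (\<lambda>x y. cscale (cv.representation B y b) x)"
  using assms by (intro cbilinearI)
    (simp_all add: cv.representation_add cv.representation_scale cscale_add_left cscale_add_right cscale_cscale mult.commute)

text \<open>The complex basis \<open>B\<close> may be infinite, so the sum needs a finite index set
  depending on \<open>t\<close>. Claiming it for every finite \<open>T\<close> above
  \<open>S\<close> is what lets the induction step join the index set of \<open>t\<close> with the
  support of \<open>y\<close>.\<close>

lemma tensor_basis_expansion:
  fixes t :: "('a::cvec, 'b::cvec) tensor"
  assumes B: "cv.independent B" "cv.span B = UNIV"
  defines "c \<equiv> \<lambda>b. tlift (\<lambda>(x::'a) (y::'b). cscale (cv.representation B y b) x)"
  shows "\<exists>S. finite S \<and> (\<forall>T. finite T \<and> S \<subseteq> T \<longrightarrow> t = (\<Sum>b\<in>T. c b t \<otimes> b))"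
proof (induct t rule: tensor_induct)
  case zero
  have "c b 0 = 0" for b
    unfolding c_def by (rule clinear_0[OF clinear_tlift[OF cbilinear_coordinate[OF B]]])
  then show ?case by (intro exI[of _ "{}"]) (simp add: tens_zero_left)
next
  case (add x y t)
  note bil = cbilinear_coordinate[OF B]
  have c: "c b (s + t) = c b s + c b t" "c b (x \<otimes> y) = cscale (cv.representation B y b) x" for b s t x y
    by (simp_all add: c_def clinear_add[OF clinear_tlift[OF bil]] tlift_tens[OF bil])
  have lin: "clinear ((\<otimes>) x :: 'b \<Rightarrow> _)"
    by (simp add: clinear_iff cbilinearD[OF cbilinear_tens])
  obtain S where S: "finite S" "\<forall>T. finite T \<and> S \<subseteq> T \<longrightarrow> t = (\<Sum>b\<in>T. c b t \<otimes> b)"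
    by (rule exE[OF add]) (erule conjE)
  let ?K = "{b. cv.representation B y b \<noteq> 0}"
  have K: "finite ?K" "(\<Sum>b\<in>?K. cscale (cv.representation B y b) b) = y"
    using cv.sum_nonzero_representation_eq[of B y] cv.finite_representation B by auto
  have *: "x \<otimes> y + t = (\<Sum>b\<in>T. c b (x \<otimes> y + t) \<otimes> b)" if T: "finite T" "S \<union> ?K \<subseteq> T" for T
  proof -
    have "y = (\<Sum>b\<in>T. cscale (cv.representation B y b) b)"
      by (subst K(2)[symmetric], rule sum.mono_neutral_left) (use T in auto)
    then have "x \<otimes> y = x \<otimes> (\<Sum>b\<in>T. cscale (cv.representation B y b) b)"
      by (rule arg_cong)
    also have "\<dots> = (\<Sum>b\<in>T. x \<otimes> cscale (cv.representation B y b) b)"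
      by (rule clinear_sum[OF lin])
    also have "\<dots> = (\<Sum>b\<in>T. c b (x \<otimes> y) \<otimes> b)"
      by (simp only: c cbilinearD[OF cbilinear_tens])
    finally have "x \<otimes> y + t = (\<Sum>b\<in>T. c b (x \<otimes> y) \<otimes> b) + (\<Sum>b\<in>T. c b t \<otimes> b)"
      by (rule arg_cong2[of _ _ _ _ "(+)"]) (rule S(2)[rule_format], use T in auto)
    also have "\<dots> = (\<Sum>b\<in>T. c b (x \<otimes> y + t) \<otimes> b)"
      by (simp only: c(1) cbilinearD[OF cbilinear_tens] sum.distrib)
    finally show ?thesis .
  qed
  have "finite (S \<union> ?K)"
    using S(1) K(1) by simp
  then show ?case
    by (intro exI[of _ "S \<union> ?K"] conjI allI impI *) auto
qed

text \<open>Write \<open>t\<close> as the sum of \<open>c b t \<otimes> b\<close> over a complex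
  basis. Applying \<open>\<phi>\<close> to the left factor gives a vector \<open>d t\<close> that is
  killed by all \<open>\<psi>\<close> and hence zero. Its coordinate at \<open>b\<close> is
  \<open>\<phi> (c b t)\<close>, so every \<open>c b t\<close> is killed by all
  \<open>\<phi>\<close>.\<close>

lemma separating_tensor:
  fixes \<Phi> :: "('a::cvec \<Rightarrow> complex) set" and \<Psi> :: "('b::cvec \<Rightarrow> complex) set"
  assumes \<Phi>: "separating \<Phi>" and \<Psi>: "separating \<Psi>"
  shows "separating (tensor_functionals \<Phi> \<Psi>)"
  unfolding separating_def
proof (intro conjI ballI allI impI)
  show "clinear \<chi>" if "\<chi> \<in> tensor_functionals \<Phi> \<Psi>" for \<chi>
    using that \<Phi> \<Psi> by (auto simp: tensor_functionals_def separating_def intro: clinear_tlift_product)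
next
  fix t :: "('a, 'b) tensor"
  assume t: "\<forall>\<chi>\<in>tensor_functionals \<Phi> \<Psi>. \<chi> t = 0"
  define B where "B = cv.extend_basis ({} :: 'b set)"
  have B: "cv.independent B" "cv.span B = UNIV"
    unfolding B_def by (simp_all add: cv.independent_extend_basis cv.independent_empty)
  define c where "c b = tlift (\<lambda>(x::'a) (y::'b). cscale (cv.representation B y b) x)" for b
  note bil = cbilinear_coordinate[OF B]
  have "c b t = 0" for b
  proof -
    have "\<phi> (c b t) = 0" if \<phi>: "\<phi> \<in> \<Phi>" for \<phi>
    proof -
      have lin: "clinear \<phi>" using \<phi> \<Phi> by (simp add: separating_def)
      define d where "d = tlift (\<lambda>(x::'a) (y::'b). cscale (\<phi> x) y)"
      have bil': "cbilinear (\<lambda>(x::'a) (y::'b). cscale (\<phi> x) y)"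
        by (rule cbilinearI)
          (simp_all add: clinear_add[OF lin] clinear_cscale[OF lin] cscale_add_left cscale_add_right
            cscale_cscale cscale_complex mult.commute)
      have "\<psi> (d t) = 0" if \<psi>: "\<psi> \<in> \<Psi>" for \<psi>
      proof -
        have lin': "clinear \<psi>" using \<psi> \<Psi> by (simp add: separating_def)
        have "\<psi> (d t) = tlift (\<lambda>x y. \<phi> x * \<psi> y) t"
          unfolding d_def
          by (rule tensor_linear_eqI[OF clinear_compose[OF lin' clinear_tlift[OF bil']]
                clinear_tlift_product[OF lin lin']])
            (simp add: tlift_tens[OF bil'] tlift_product_tens[OF lin lin'] clinear_cscale[OF lin'] cscale_complex)
        then show ?thesis
          using t \<phi> \<psi> by (auto simp: tensor_functionals_def)
      qed
      then have "d t = 0" using \<Psi> by (simp add: separating_def)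
      moreover have "\<phi> (c b t) = cv.representation B (d t) b"
      proof -
        have r: "clinear (\<lambda>y. cv.representation B y b)"
          by (simp add: clinear_iff B cv.representation_add cv.representation_scale cscale_complex)
        show ?thesis
          unfolding c_def d_def
          by (rule tensor_linear_eqI[OF clinear_compose[OF lin clinear_tlift[OF bil]]
                clinear_compose[OF r clinear_tlift[OF bil']]])
            (simp add: tlift_tens[OF bil] tlift_tens[OF bil'] clinear_cscale[OF lin] clinear_cscale[OF r]
              cscale_complex mult.commute)
      qed
      ultimately show ?thesis by (simp add: cv.representation_zero)
    qed
    then show ?thesis using \<Phi> by (simp add: separating_def)
  qed
  note c0 = this
  have "\<exists>S. finite S \<and> (\<forall>T. finite T \<and> S \<subseteq> T \<longrightarrow> t = (\<Sum>b\<in>T. c b t \<otimes> b))"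
    unfolding c_def by (rule tensor_basis_expansion[OF B])
  then obtain S where "t = (\<Sum>b\<in>S. c b t \<otimes> b)" by blast
  also have "\<dots> = 0" by (simp add: c0 tens_zero_left)
  finally show "t = 0" .
qed

section \<open>The bowtie product\<close>

text \<open>Associative conformal algebras without associativity. The bowtie product is of this kind
  for arbitrary module homomorphisms, and its associativity is then the question.\<close>

definition conformal_product :: "'a::cdmod lambda_product \<Rightarrow> bool" where
  "conformal_product m \<longleftrightarrow> cbilinear m \<and>
     (\<forall>a b \<kappa>. pev (m (der a) b) \<kappa> = - cscale \<kappa> (pev (m a b) \<kappa>)) \<and>
     (\<forall>a b \<kappa>. pev (m a (der b)) \<kappa> = der (pev (m a b) \<kappa>) + cscale \<kappa> (pev (m a b) \<kappa>))"

lemma assoc_conformal_algebra_iff: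
  "assoc_conformal_algebra m \<longleftrightarrow> conformal_product m \<and>
     (\<forall>a b c \<kappa> \<mu>. pev (m (pev (m a b) \<kappa>) c) (\<kappa> + \<mu>) = pev (m a (pev (m b c) \<mu>)) \<kappa>)"
  by (auto simp: assoc_conformal_algebra_def conformal_product_def)

lemma pev_product_linear:
  assumes "cbilinear m"
  shows "pev (m (a + a') b) \<kappa> = pev (m a b) \<kappa> + pev (m a' b) \<kappa>"
    and "pev (m a (b + b')) \<kappa> = pev (m a b) \<kappa> + pev (m a b') \<kappa>"
    and "pev (m (cscale c a) b) \<kappa> = cscale c (pev (m a b) \<kappa>)"
    and "pev (m a (cscale c b)) \<kappa> = cscale c (pev (m a b) \<kappa>)"
  by (simp_all add: cbilinearD[OF assms] clinear_add[OF clinear_pev] clinear_cscale[OF clinear_pev])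

lemma cbilinear_zero:
  assumes "cbilinear m"
  shows "m 0 b = 0" "m a 0 = 0"
  using cbilinearD(2)[OF assms, of 0 0 b] cbilinearD(4)[OF assms, of a 0 0] by simp_all

lemma capp_zero: "T \<cdot> 0 = 0"
  by (rule clinear_0[OF clinear_capp])

lemma chom_zero_app: "0 \<cdot> u = 0"
  by (rule zero_chom.rep_eq[THEN fun_cong])

lemma associative_prodI:
  fixes M :: "('a::cdmod \<times> 'b::cdmod) lambda_product"
  assumes M: "cbilinear M"
    and pure: "\<And>u v w \<kappa> \<mu>. fst u = 0 \<or> snd u = 0 \<Longrightarrow> fst v = 0 \<or> snd v = 0 \<Longrightarrow> fst w = 0 \<or> snd w = 0 \<Longrightarrow>
      pev (M (pev (M u v) \<kappa>) w) (\<kappa> + \<mu>) = pev (M u (pev (M v w) \<mu>)) \<kappa>"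
  shows "pev (M (pev (M u v) \<kappa>) w) (\<kappa> + \<mu>) = pev (M u (pev (M v w) \<mu>)) \<kappa>"
proof -
  have split: "x = (fst x, 0) + (0, snd x)" for x :: "'a \<times> 'b" by simp
  note lin = pev_product_linear(1,2)[OF M]
  have 1: "pev (M (pev (M u v) \<kappa>) w) (\<kappa> + \<mu>) = pev (M u (pev (M v w) \<mu>)) \<kappa>"
    if "fst u = 0 \<or> snd u = 0" "fst v = 0 \<or> snd v = 0" for u v w
    by (subst (1 2) split[of w], simp only: lin, intro arg_cong2[of _ _ _ _ "(+)"] pure that)
      simp_all
  have 2: "pev (M (pev (M u v) \<kappa>) w) (\<kappa> + \<mu>) = pev (M u (pev (M v w) \<mu>)) \<kappa>"
    if "fst u = 0 \<or> snd u = 0" for u v w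
    by (subst (1 2) split[of v], simp only: lin, intro arg_cong2[of _ _ _ _ "(+)"] 1 that)
      simp_all
  show ?thesis
    by (subst (1 2) split[of u], simp only: lin, intro arg_cong2[of _ _ _ _ "(+)"] 2)
      simp_all
qed

text \<open>The product of \<open>a + x\<close> and \<open>b + y\<close> on the direct sum, with
  \<open>l\<close> acting from the left and \<open>r\<close> from the right. A right action is taken
  at \<open>- \<kappa> - der\<close>, as in \<open>R_op\<close>, whence
  \<open>pflip\<close>.\<close>

definition bowtie ::
    "'a::cdmod lambda_product \<Rightarrow> 'b::cdmod lambda_product \<Rightarrow>
     ('a \<Rightarrow> 'b cend) \<Rightarrow> ('a \<Rightarrow> 'b cend) \<Rightarrow> ('b \<Rightarrow> 'a cend) \<Rightarrow> ('b \<Rightarrow> 'a cend) \<Rightarrow> ('a \<times> 'b) lambda_product" where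
  "bowtie mA mB lA rA lB rB u v =
     map_poly (\<lambda>c. (c, 0)) (mA (fst u) (fst v) + pflip (rB (snd v) \<cdot> fst u) + lB (snd u) \<cdot> fst v) +
     map_poly (\<lambda>z. (0, z)) (mB (snd u) (snd v) + lA (fst u) \<cdot> snd v + pflip (rA (fst v) \<cdot> snd u))"

lemma clinear_inl: "clinear (\<lambda>c. (c, 0))" and clinear_inr: "clinear (\<lambda>c. (0, c))"
  by (simp_all add: clinear_iff cscale_prod_def)

lemma pev_bowtie:
  "pev (bowtie mA mB lA rA lB rB u v) \<kappa> =
     (pev (mA (fst u) (fst v)) \<kappa> + pevd (rB (snd v) \<cdot> fst u) \<kappa> + pev (lB (snd u) \<cdot> fst v) \<kappa>,
      pev (mB (snd u) (snd v)) \<kappa> + pev (lA (fst u) \<cdot> snd v) \<kappa> + pevd (rA (fst v) \<cdot> snd u) \<kappa>)"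
  unfolding bowtie_def
  by (simp add: clinear_add[OF clinear_pev] pev_map_poly[OF clinear_inl] pev_map_poly[OF clinear_inr] pev_pflip)

lemma pevd_chom_der: "pevd (T \<cdot> der u) \<kappa> = - cscale \<kappa> (pevd (T \<cdot> u) \<kappa>)"
proof -
  have "T \<cdot> der u = der (T \<cdot> u) + pCons 0 (T \<cdot> u)"
    by (rule pev_inject) (simp add: pev_chom_der clinear_add[OF clinear_pev] pev_der pev_pCons)
  moreover have "pevd (der p) \<kappa> = der (pevd p \<kappa>)" for p :: "'a poly"
    by (induct p)
      (simp_all add: pevd_0 clinear_0[OF clinear_der] der_poly_def map_poly_pCons pevd_pCons
        clinear_add[OF clinear_der] clinear_diff[OF clinear_der] der_cscale)
  ultimately show ?thesis
    by (simp add: clinear_add[OF clinear_pevd] pevd_pCons clinear_minus[OF clinear_der])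
qed

lemma pevd_der_chom: "pevd (der T \<cdot> u) \<kappa> = cscale \<kappa> (pevd (T \<cdot> u) \<kappa>) + der (pevd (T \<cdot> u) \<kappa>)"
  by (simp add: der_chom.rep_eq clinear_minus[OF clinear_pevd] pevd_pCons clinear_minus[OF clinear_der])

lemma cd_hom_D:
  assumes "cd_hom f"
  shows "f (x + y) = f x + f y" "f (cscale c x) = cscale c (f x)" "f (der x) = der (f x)" "f 0 = 0"
  using assms by (simp_all add: cd_hom_iff clinear_add clinear_cscale clinear_0)

lemma conformal_product_bowtie:
  assumes mA: "conformal_product mA" and mB: "conformal_product mB"
    and hom: "cd_hom lA" "cd_hom rA" "cd_hom lB" "cd_hom rB"
  shows "conformal_product (bowtie mA mB lA rA lB rB)"
proof -
  have bil: "cbilinear mA" "cbilinear mB"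
    using mA mB by (simp_all add: conformal_product_def)
  note simps = pev_bowtie clinear_add[OF clinear_pev] clinear_cscale[OF clinear_pev]
      clinear_add[OF clinear_pevd] clinear_cscale[OF clinear_pevd]
      pev_product_linear[OF bil(1)] pev_product_linear[OF bil(2)] capp_add capp_cscale
      plus_chom.rep_eq cscale_chom.rep_eq cscale_prod_def cscale_add_right
      hom[THEN cd_hom_D(1)] hom[THEN cd_hom_D(2)]
  have "cbilinear (bowtie mA mB lA rA lB rB)"
    by (intro cbilinearI pev_inject) (simp_all add: simps)
  moreover have "pev (mA (der a) b) \<kappa> = - cscale \<kappa> (pev (mA a b) \<kappa>)"
    "pev (mA a (der b)) \<kappa> = der (pev (mA a b) \<kappa>) + cscale \<kappa> (pev (mA a b) \<kappa>)" for a b \<kappa>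
    using mA by (simp_all add: conformal_product_def)
  moreover have "pev (mB (der a) b) \<kappa> = - cscale \<kappa> (pev (mB a b) \<kappa>)"
    "pev (mB a (der b)) \<kappa> = der (pev (mB a b) \<kappa>) + cscale \<kappa> (pev (mB a b) \<kappa>)" for a b \<kappa>
    using mB by (simp_all add: conformal_product_def)
  ultimately show ?thesis
    unfolding conformal_product_def
    by (simp add: pev_bowtie der_prod_def cscale_prod_def hom[THEN cd_hom_D(3)] pev_der_chom
        pevd_der_chom pev_chom_der pevd_chom_der der_add cscale_add_right prod_eq_iff)
qed

text \<open>Associativity on a triple with letters from both summands has two components: one is a
  bimodule identity, the other a compatibility equation of \<open>matched_pair\<close>. The six
  kinds of mixed triples account for all six bimodule identities and all six compatibility
  equations, each exactly once.\<close>

lemma assoc_bowtie_iff_matched_pair: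
  assumes mA: "assoc_conformal_algebra mA" and mB: "assoc_conformal_algebra mB"
    and hom: "cd_hom lA" "cd_hom rA" "cd_hom lB" "cd_hom rB"
  shows "assoc_conformal_algebra (bowtie mA mB lA rA lB rB) \<longleftrightarrow> matched_pair mA mB lA rA lB rB"
proof -
  let ?M = "bowtie mA mB lA rA lB rB"
  have M: "conformal_product ?M"
    using conformal_product_bowtie mA mB hom by (auto simp: assoc_conformal_algebra_iff)
  have bil: "cbilinear mA" "cbilinear mB" "cbilinear ?M"
    using mA mB M by (simp_all add: assoc_conformal_algebra_iff conformal_product_def)
  have asc: "pev (mA (pev (mA a b) \<kappa>) c) (\<kappa> + \<mu>) = pev (mA a (pev (mA b c) \<mu>)) \<kappa>"
    "pev (mB (pev (mB x y) \<kappa>) z) (\<kappa> + \<mu>) = pev (mB x (pev (mB y z) \<mu>)) \<kappa>" for a b c x y z \<kappa> \<mu>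
    using mA mB by (simp_all add: assoc_conformal_algebra_iff)
  note simps = pev_bowtie bil(1,2)[THEN cbilinear_zero(1)] bil(1,2)[THEN cbilinear_zero(2)]
    capp_zero chom_zero_app hom[THEN cd_hom_D(4)] pev_0 pevd_0 asc
  define assoc where "assoc u v w \<longleftrightarrow>
    (\<forall>\<kappa> \<mu>. pev (?M (pev (?M u v) \<kappa>) w) (\<kappa> + \<mu>) = pev (?M u (pev (?M v w) \<mu>)) \<kappa>)" for u v w
  have AAB: "assoc (a, 0) (b, 0) (0, x) \<longleftrightarrow> (\<forall>\<kappa> \<mu>.
      pevd (rB x \<cdot> pev (mA a b) \<kappa>) (\<kappa> + \<mu>) =
        pev (mA a (pevd (rB x \<cdot> b) \<mu>)) \<kappa> + pevd (rB (pev (lA b \<cdot> x) \<mu>) \<cdot> a) \<kappa> \<and>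
      pev (lA (pev (mA a b) \<kappa>) \<cdot> x) (\<kappa> + \<mu>) = pev (lA a \<cdot> pev (lA b \<cdot> x) \<mu>) \<kappa>)" for a b x
    unfolding assoc_def by (simp add: simps)
  have ABA: "assoc (a, 0) (0, x) (b, 0) \<longleftrightarrow> (\<forall>\<kappa> \<mu>.
      pev (mA a (pev (lB x \<cdot> b) \<mu>)) \<kappa> + pevd (rB (pevd (rA b \<cdot> x) \<mu>) \<cdot> a) \<kappa> =
        pev (mA (pevd (rB x \<cdot> a) \<kappa>) b) (\<kappa> + \<mu>) + pev (lB (pev (lA a \<cdot> x) \<kappa>) \<cdot> b) (\<kappa> + \<mu>) \<and>
      pev (lA a \<cdot> pevd (rA b \<cdot> x) \<mu>) \<kappa> = pevd (rA b \<cdot> pev (lA a \<cdot> x) \<kappa>) (\<kappa> + \<mu>))" for a b x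
    unfolding assoc_def by (simp add: simps eq_commute add.commute)
  have BAA: "assoc (0, x) (a, 0) (b, 0) \<longleftrightarrow> (\<forall>\<kappa> \<mu>.
      pev (lB x \<cdot> pev (mA a b) \<mu>) \<kappa> =
        pev (mA (pev (lB x \<cdot> a) \<kappa>) b) (\<kappa> + \<mu>) + pev (lB (pevd (rA a \<cdot> x) \<kappa>) \<cdot> b) (\<kappa> + \<mu>) \<and>
      pevd (rA b \<cdot> pevd (rA a \<cdot> x) \<kappa>) (\<kappa> + \<mu>) = pevd (rA (pev (mA a b) \<mu>) \<cdot> x) \<kappa>)" for a b x
    unfolding assoc_def by (simp add: simps eq_commute add.commute)
  have BBA: "assoc (0, x) (0, y) (a, 0) \<longleftrightarrow> (\<forall>\<kappa> \<mu>.
      pev (lB (pev (mB x y) \<kappa>) \<cdot> a) (\<kappa> + \<mu>) = pev (lB x \<cdot> pev (lB y \<cdot> a) \<mu>) \<kappa> \<and>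
      pevd (rA (pev (lB y \<cdot> a) \<mu>) \<cdot> x) \<kappa> + pev (mB x (pevd (rA a \<cdot> y) \<mu>)) \<kappa> =
        pevd (rA a \<cdot> pev (mB x y) \<kappa>) (\<kappa> + \<mu>))" for a x y
    unfolding assoc_def by (simp add: simps eq_commute add.commute)
  have BAB: "assoc (0, x) (a, 0) (0, y) \<longleftrightarrow> (\<forall>\<kappa> \<mu>.
      pev (lB x \<cdot> pevd (rB y \<cdot> a) \<mu>) \<kappa> = pevd (rB y \<cdot> pev (lB x \<cdot> a) \<kappa>) (\<kappa> + \<mu>) \<and>
      pevd (rA (pevd (rB y \<cdot> a) \<mu>) \<cdot> x) \<kappa> + pev (mB x (pev (lA a \<cdot> y) \<mu>)) \<kappa> =
        pev (lA (pev (lB x \<cdot> a) \<kappa>) \<cdot> y) (\<kappa> + \<mu>) + pev (mB (pevd (rA a \<cdot> x) \<kappa>) y) (\<kappa> + \<mu>))" for a x y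
    unfolding assoc_def by (simp add: simps eq_commute add.commute)
  have ABB: "assoc (a, 0) (0, x) (0, y) \<longleftrightarrow> (\<forall>\<kappa> \<mu>.
      pevd (rB y \<cdot> pevd (rB x \<cdot> a) \<kappa>) (\<kappa> + \<mu>) = pevd (rB (pev (mB x y) \<mu>) \<cdot> a) \<kappa> \<and>
      pev (lA a \<cdot> pev (mB x y) \<mu>) \<kappa> =
        pev (mB (pev (lA a \<cdot> x) \<kappa>) y) (\<kappa> + \<mu>) + pev (lA (pevd (rB x \<cdot> a) \<kappa>) \<cdot> y) (\<kappa> + \<mu>))" for a x y
    unfolding assoc_def by (simp add: simps eq_commute add.commute)
  note mixed = AAB ABA BAA BBA BAB ABB
  have pure: "assoc (a, 0) (b, 0) (c, 0)" "assoc (0, x) (0, y) (0, z)" for a b c x y z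
    unfolding assoc_def by (simp_all add: simps)
  have "matched_pair mA mB lA rA lB rB \<longleftrightarrow>
      (\<forall>a b x. assoc (a, 0) (b, 0) (0, x) \<and> assoc (a, 0) (0, x) (b, 0) \<and> assoc (0, x) (a, 0) (b, 0)) \<and>
      (\<forall>x y a. assoc (0, x) (0, y) (a, 0) \<and> assoc (0, x) (a, 0) (0, y) \<and> assoc (a, 0) (0, x) (0, y))"
    (is "_ \<longleftrightarrow> ?mixed")
    unfolding mixed matched_pair_def bimodule_def
    unfolding all_conj_distrib
    by (intro iffI; elim conjE; intro conjI mA mB hom allI; meson)
  moreover have "?mixed \<longleftrightarrow> (\<forall>u v w. assoc u v w)"
  proof
    assume mixed: ?mixed
    have "assoc u v w" for u v w
      unfolding assoc_def
    proof (intro allI, rule associative_prodI[OF bil(3)])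
      fix u v w :: "'a \<times> 'b" and \<kappa> \<mu>
      assume "fst u = 0 \<or> snd u = 0" "fst v = 0 \<or> snd v = 0" "fst w = 0 \<or> snd w = 0"
      then have "assoc u v w"
        using mixed pure by (cases u; cases v; cases w) auto
      then show "pev (?M (pev (?M u v) \<kappa>) w) (\<kappa> + \<mu>) = pev (?M u (pev (?M v w) \<mu>)) \<kappa>"
        by (simp add: assoc_def)
    qed
    then show "\<forall>u v w. assoc u v w" by blast
  qed blast
  moreover have "assoc_conformal_algebra ?M \<longleftrightarrow> (\<forall>u v w. assoc u v w)"
    using M unfolding assoc_conformal_algebra_iff assoc_def by blast
  ultimately show ?thesis by simp
qed

section \<open>Associativity and invariant forms\<close>

text \<open>
  For an invariant form, associativity of the product is a cyclic symmetry of the four-point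
  function \<open>\<langle>u\<^sub>k v, w\<^sub>r z\<rangle>\<^bsub>k+l\<^esub>\<close>, whose four arguments carry spectral parameters with sum zero.
\<close>

locale invariant_product =
  fixes M :: "'v::cdmod lambda_product" and \<beta> :: "'v \<Rightarrow> 'v \<Rightarrow> complex poly"
  assumes product: "cbilinear M" and form: "cbilinear \<beta>"
    and sym: "poly (\<beta> u v) \<kappa> = poly (\<beta> v u) (- \<kappa>)"
    and separates: "(\<And>v \<kappa>. poly (\<beta> u v) \<kappa> = 0) \<Longrightarrow> u = 0"
    and inv: "poly (\<beta> (pev (M u v) \<kappa>) w) \<mu> = poly (\<beta> u (pev (M v w) (\<mu> - \<kappa>))) \<kappa>"
begin

definition four_point where
  "four_point u k v l w r z = poly (\<beta> (pev (M u v) k) (pev (M w z) r)) (k + l)"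

definition cyclic where
  "cyclic u k v l w r z s \<longleftrightarrow> four_point u k v l w r z = four_point v l w r z s u"

lemma form_eqI:
  assumes "\<And>w \<kappa>. poly (\<beta> u w) \<kappa> = poly (\<beta> v w) \<kappa>"
  shows "u = v"
proof -
  have "\<beta> (u - v) w = \<beta> u w - \<beta> v w" for w
    using form clinear_diff[of "\<lambda>u. \<beta> u w"] by (simp add: cbilinear_def)
  then have "u - v = 0" using assms by (intro separates) simp
  then show ?thesis by simp
qed

lemma four_point_sym:
  assumes "k + l + r + s = 0"
  shows "four_point u k v l w r z = four_point w r z s u k v"
proof -
  have "r + s = - (k + l)" using assms by (simp add: add_eq_0_iff algebra_simps)
  then show ?thesis
    unfolding four_point_def by (subst sym) simp
qed

text \<open>By \<open>four_point_sym\<close> two rotations together leave the value unchanged, so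
  the rotation starting at \<open>u\<close> and the one starting at \<open>v\<close> give the same
  equation, read from opposite sides.\<close>

lemma cyclic_rotate:
  assumes "k + l + r + s = 0"
  shows "cyclic u k v l w r z s \<longleftrightarrow> cyclic v l w r z s u k"
  unfolding cyclic_def using four_point_sym[OF assms] by auto

lemma cyclic_add:
  assumes "cyclic u k v l w r z s" "cyclic u k v l w r z' s"
  shows "cyclic u k v l w r (z + z') s"
  using assms unfolding cyclic_def four_point_def
  by (simp add: cbilinearD[OF product] cbilinearD[OF form] clinear_add[OF clinear_pev])

text \<open>Test both sides against \<open>z\<close> at parameter \<open>- s\<close>. The left side
  needs invariance once. On the right, invariance splits off \<open>u\<close>, symmetry brings it to
  the end, and invariance applies once more. Since the form separates points, testing loses
  nothing.\<close>

lemma associative_iff_cyclic: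
  "pev (M (pev (M u v) \<kappa>) w) (\<kappa> + \<mu>) = pev (M u (pev (M v w) \<mu>)) \<kappa> \<longleftrightarrow>
   (\<forall>r z s. \<kappa> + \<mu> + r + s = 0 \<longrightarrow> cyclic u \<kappa> v \<mu> w r z s)"
proof -
  have left: "poly (\<beta> (pev (M (pev (M u v) \<kappa>) w) (\<kappa> + \<mu>)) z) (- s) = four_point u \<kappa> v \<mu> w r z"
    and right: "poly (\<beta> (pev (M u (pev (M v w) \<mu>)) \<kappa>) z) (- s) = four_point v \<mu> w r z s u"
    if "\<kappa> + \<mu> + r + s = 0" for r z s
  proof -
    have s_eq: "s = - (\<kappa> + \<mu> + r)" using minus_unique[OF that] by simp
    have s: "- s - (\<kappa> + \<mu>) = r" and s': "- s - \<kappa> = \<mu> + r" by (simp_all add: s_eq)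
    show "poly (\<beta> (pev (M (pev (M u v) \<kappa>) w) (\<kappa> + \<mu>)) z) (- s) = four_point u \<kappa> v \<mu> w r z"
      by (simp only: inv s four_point_def)
    have "poly (\<beta> (pev (M u (pev (M v w) \<mu>)) \<kappa>) z) (- s) = poly (\<beta> u (pev (M (pev (M v w) \<mu>) z) (\<mu> + r))) \<kappa>"
      by (simp only: inv s')
    also have "\<dots> = poly (\<beta> (pev (M (pev (M v w) \<mu>) z) (\<mu> + r)) u) (- \<kappa>)"
      by (rule sym)
    also have "\<dots> = poly (\<beta> (pev (M v w) \<mu>) (pev (M z u) (- \<kappa> - (\<mu> + r)))) (\<mu> + r)"
      by (rule inv)
    also have "- \<kappa> - (\<mu> + r) = s" by (simp add: s_eq)
    finally show "poly (\<beta> (pev (M u (pev (M v w) \<mu>)) \<kappa>) z) (- s) = four_point v \<mu> w r z s u"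
      by (simp only: four_point_def)
  qed
  show ?thesis
  proof
    assume "pev (M (pev (M u v) \<kappa>) w) (\<kappa> + \<mu>) = pev (M u (pev (M v w) \<mu>)) \<kappa>"
    then show "\<forall>r z s. \<kappa> + \<mu> + r + s = 0 \<longrightarrow> cyclic u \<kappa> v \<mu> w r z s"
      unfolding cyclic_def using left right by metis
  next
    assume *: "\<forall>r z s. \<kappa> + \<mu> + r + s = 0 \<longrightarrow> cyclic u \<kappa> v \<mu> w r z s"
    show "pev (M (pev (M u v) \<kappa>) w) (\<kappa> + \<mu>) = pev (M u (pev (M v w) \<mu>)) \<kappa>"
    proof (rule form_eqI)
      fix z \<nu>
      \<comment> \<open>Testing at \<open>\<nu>\<close> forces \<open>s = - \<nu>\<close>, and the
        zero sum then determines \<open>r\<close>.\<close>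
      have "\<kappa> + \<mu> + (\<nu> - \<kappa> - \<mu>) + (- \<nu>) = 0" by simp
      then show "poly (\<beta> (pev (M (pev (M u v) \<kappa>) w) (\<kappa> + \<mu>)) z) \<nu> = poly (\<beta> (pev (M u (pev (M v w) \<mu>)) \<kappa>) z) \<nu>"
        using * left[of "\<nu> - \<kappa> - \<mu>" "- \<nu>" z] right[of "\<nu> - \<kappa> - \<mu>" "- \<nu>" z]
        unfolding cyclic_def by simp
    qed
  qed
qed

text \<open>
  For two complementary subalgebras, there are only six cyclic words of length four in the two
  summands. Four of them have three consecutive equal letters and concern one subalgebra only.
\<close>

lemma cyclic_words:
  assumes P: "\<And>u v w \<kappa> \<mu>. P u \<Longrightarrow> P v \<Longrightarrow> P w \<Longrightarrow>
      pev (M (pev (M u v) \<kappa>) w) (\<kappa> + \<mu>) = pev (M u (pev (M v w) \<mu>)) \<kappa>"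
    and N: "\<And>u v w \<kappa> \<mu>. N u \<Longrightarrow> N v \<Longrightarrow> N w \<Longrightarrow>
      pev (M (pev (M u v) \<kappa>) w) (\<kappa> + \<mu>) = pev (M u (pev (M v w) \<mu>)) \<kappa>"
    and PPNN: "\<And>u v w z k l r s. k + l + r + s = 0 \<Longrightarrow> P u \<Longrightarrow> P v \<Longrightarrow> N w \<Longrightarrow> N z \<Longrightarrow> cyclic u k v l w r z s"
    and PNPN: "\<And>u v w z k l r s. k + l + r + s = 0 \<Longrightarrow> P u \<Longrightarrow> N v \<Longrightarrow> P w \<Longrightarrow> N z \<Longrightarrow> cyclic u k v l w r z s"
    and sum: "k + l + r + s = 0"
    and uvwz: "P u \<or> N u" "P v \<or> N v" "P w \<or> N w" "P z \<or> N z"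
  shows "cyclic u k v l w r z s"
proof -
  have three: "cyclic u k v l w r z s" if "k + l + r + s = 0" "P u \<and> P v \<and> P w \<or> N u \<and> N v \<and> N w"
    for u k v l w r z s
    using that P N associative_iff_cyclic by blast
  have rot: "l + r + s + k = 0" "r + s + k + l = 0" "s + k + l + r = 0"
    using sum by (simp_all add: algebra_simps)
  have rotate: "cyclic u k v l w r z s \<longleftrightarrow> cyclic v l w r z s u k"
    "cyclic u k v l w r z s \<longleftrightarrow> cyclic w r z s u k v l"
    "cyclic u k v l w r z s \<longleftrightarrow> cyclic z s u k v l w r"
    using cyclic_rotate[OF sum] cyclic_rotate[OF rot(1)] cyclic_rotate[OF rot(2)] cyclic_rotate[OF rot(3)]
    by blast+
  \<comment> \<open>Every word of length four in two letters has a rotation that begins with three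
    equal letters or equals PPNN or PNPN. The last word returns to itself after two rotations, so
    two instances cover it.\<close>
  show ?thesis
    using three[OF sum, of u v w z] three[OF rot(1), of v w z u] three[OF rot(2), of w z u v]
      three[OF rot(3), of z u v w] PPNN[OF sum, of u v w z] PPNN[OF rot(1), of v w z u]
      PPNN[OF rot(2), of w z u v] PPNN[OF rot(3), of z u v w] PNPN[OF sum, of u v w z]
      PNPN[OF rot(1), of v w z u] uvwz
    unfolding rotate[symmetric]
    by argo
qed

end

section \<open>Pairing tensors with conformal functionals\<close>

text \<open>The tensor product of \<open>f\<close> at \<open>\<alpha>\<close> and \<open>g\<close>
  at \<open>\<gamma>\<close>. With independent parameters it covers the dual product, where they are
  \<open>\<kappa>\<close> and \<open>\<mu> - \<kappa>\<close>, and \<open>der\<close> acts under it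
  by the scalar \<open>\<alpha> + \<gamma>\<close>.\<close>

definition dual_pairing ::
    "'a::cdmod cdual \<Rightarrow> complex \<Rightarrow> 'b::cdmod cdual \<Rightarrow> complex \<Rightarrow> ('a, 'b) tensor \<Rightarrow> complex" where
  "dual_pairing f \<alpha> g \<gamma> = tlift (\<lambda>x y. poly (f \<cdot> x) \<alpha> * poly (g \<cdot> y) \<gamma>)"

lemma clinear_dual_pairing: "clinear (dual_pairing f \<alpha> g \<gamma>)"
  unfolding dual_pairing_def by (rule clinear_tlift_product[OF clinear_cdual clinear_cdual])

lemma dual_pairing_tens: "dual_pairing f \<alpha> g \<gamma> (x \<otimes> y) = poly (f \<cdot> x) \<alpha> * poly (g \<cdot> y) \<gamma>"
  unfolding dual_pairing_def by (rule tlift_product_tens[OF clinear_cdual clinear_cdual])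

lemma der_tens: "der (x \<otimes> y) = der x \<otimes> y + x \<otimes> der y"
proof -
  have "cbilinear (\<lambda>(a::'a) (b::'b). der a \<otimes> b + a \<otimes> der b)"
    by (rule cbilinearI)
      (simp_all add: der_add der_cscale cbilinearD[OF cbilinear_tens] cscale_add_right)
  then show ?thesis unfolding der_tensor_def by (rule tlift_tens)
qed

lemma clinear_cmult: "clinear ((*) (c::complex))"
  by (simp add: clinear_iff cscale_complex algebra_simps)

lemma dual_pairing_der: "dual_pairing f \<alpha> g \<gamma> (der t) = (\<alpha> + \<gamma>) * dual_pairing f \<alpha> g \<gamma> t"
  by (rule tensor_linear_eqI[OF clinear_compose[OF clinear_dual_pairing clinear_der]
        clinear_compose[OF clinear_cmult clinear_dual_pairing]])
    (simp add: der_tens clinear_add[OF clinear_dual_pairing] dual_pairing_tens poly_cdual_der algebra_simps)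

lemma dual_pairing_pevd_left: "dual_pairing (pevd p \<nu>) \<alpha> g \<gamma> = dual_pairing (pev p (\<alpha> - \<nu>)) \<alpha> g \<gamma>"
  by (simp add: dual_pairing_def cdual_pevd)

lemma dual_pairing_pevd_right: "dual_pairing f \<alpha> (pevd p \<nu>) \<gamma> = dual_pairing f \<alpha> (pev p (\<gamma> - \<nu>)) \<gamma>"
  by (simp add: dual_pairing_def cdual_pevd)

lemma clinear_tens: "clinear (\<lambda>z. x \<otimes> z)" "clinear (\<lambda>z. z \<otimes> y)"
  by (simp_all add: clinear_iff cbilinearD[OF cbilinear_tens])

lemma cbilinear_tensor_right: "cbilinear (\<lambda>x y. map_poly (\<lambda>z. x \<otimes> z) (T \<cdot> y))"
  by (intro cbilinearI pev_inject, unfold clinear_add[OF clinear_pev] clinear_cscale[OF clinear_pev] pev_map_poly[OF clinear_tens(1)])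
    (simp_all add: clinear_add[OF clinear_pev] clinear_cscale[OF clinear_pev] capp_add capp_cscale
      cbilinearD[OF cbilinear_tens])

lemma cbilinear_tensor_left: "cbilinear (\<lambda>x y. map_poly (\<lambda>z. z \<otimes> y) (T \<cdot> x))"
  by (intro cbilinearI pev_inject, unfold clinear_add[OF clinear_pev] clinear_cscale[OF clinear_pev] pev_map_poly[OF clinear_tens(2)])
    (simp_all add: clinear_add[OF clinear_pev] clinear_cscale[OF clinear_pev] capp_add capp_cscale
      cbilinearD[OF cbilinear_tens])

lemma dual_pairing_pevd: "dual_pairing f \<alpha> g \<gamma> (pevd p \<kappa>) = dual_pairing f \<alpha> g \<gamma> (pev p (- \<kappa> - \<alpha> - \<gamma>))"
  using functional_pevd[of "dual_pairing f \<alpha> g \<gamma>" "\<alpha> + \<gamma>" p \<kappa>]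
  by (simp add: clinear_dual_pairing dual_pairing_der cscale_complex diff_diff_eq)

lemma cbilinear_swap: "cbilinear (\<lambda>(a::'a::cvec) (b::'b::cvec). b \<otimes> a)"
  by (rule cbilinearI) (simp_all add: cbilinearD[OF cbilinear_tens])

lemma clinear_tswap: "clinear tswap"
  unfolding tswap_def by (rule clinear_tlift[OF cbilinear_swap])

lemma tswap_tens: "tswap (x \<otimes> y) = y \<otimes> x"
  unfolding tswap_def by (rule tlift_tens[OF cbilinear_swap])

lemma dual_pairing_tswap: "dual_pairing f \<alpha> g \<gamma> (tswap t) = dual_pairing g \<gamma> f \<alpha> t"
  by (rule tensor_linear_eqI[OF clinear_compose[OF clinear_dual_pairing clinear_tswap] clinear_dual_pairing])
    (simp add: tswap_tens dual_pairing_tens)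

section \<open>Duals over finite free modules\<close>

lemma clinear_pscale_left: "clinear (\<lambda>q. pscale q x)"
  by (simp add: clinear_iff pscale_add_left cscale_poly_eq_smult pscale_smult)

lemma capp_pscale: "f \<cdot> pscale q x = q * (f \<cdot> x)" for f :: "'a::cdmod cdual"
  by (rule conf_linear_pscale[OF capp_conf_linear])

lemma poly_pscale_cdual: "poly (pscale q f \<cdot> x) \<kappa> = poly q (- \<kappa>) * poly (f \<cdot> x) \<kappa>"
  for f :: "'a::cdmod cdual"
  by (induct q)
    (simp_all add: pscale_0 chom_zero_app pscale_pCons plus_chom.rep_eq cscale_chom.rep_eq poly_cscale
      poly_der_cdual algebra_simps)

text \<open>A polynomial over the dual is determined by all its scalar values, so uniqueness is
  automatic and only existence remains for the \<open>THE\<close> in \<open>dual_product\<close> and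
  in \<open>cend_dual\<close>.\<close>

lemma the_cdual_poly:
  assumes "\<exists>p :: 'a::cdmod cdual poly. \<forall>\<kappa> \<mu> a. pev (pev p \<kappa> \<cdot> a) \<mu> = H \<kappa> \<mu> a"
  shows "pev (pev (THE p :: 'a cdual poly. \<forall>\<kappa> \<mu> a. pev (pev p \<kappa> \<cdot> a) \<mu> = H \<kappa> \<mu> a) \<kappa> \<cdot> a) \<mu> = H \<kappa> \<mu> a"
proof -
  have "\<exists>!p :: 'a cdual poly. \<forall>\<kappa> \<mu> a. pev (pev p \<kappa> \<cdot> a) \<mu> = H \<kappa> \<mu> a"
  proof (rule ex_ex1I[OF assms])
    fix p q :: "'a cdual poly"
    assume "\<forall>\<kappa> \<mu> a. pev (pev p \<kappa> \<cdot> a) \<mu> = H \<kappa> \<mu> a" "\<forall>\<kappa> \<mu> a. pev (pev q \<kappa> \<cdot> a) \<mu> = H \<kappa> \<mu> a"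
    then show "p = q"
      by (intro pev_inject cdual_eqI) (simp add: pev_complex)
  qed
  from theI'[OF this] show ?thesis by blast
qed

text \<open>Bridges the two hypotheses of finite generation and freeness. Only the finitely many
  basis elements in \<open>C\<close> occur in the expansions of \<open>S\<close>, so
  \<open>C\<close> spans; uniqueness of representations then leaves no room for a basis element
  outside \<open>C\<close>.\<close>

lemma finite_basis_of_finite_span:
  fixes S B :: "'a::cdmod set"
  assumes S: "finite S" "cd.span S = UNIV" and B: "cd.independent B" "cd.span B = UNIV"
  shows "finite B"
proof -
  define C where "C = (\<Union>s\<in>S. {b. cd.representation B s b \<noteq> 0})"
  have fin: "finite C" using S(1) by (simp add: C_def cd.finite_representation)
  have CB: "C \<subseteq> B" using cd.representation_ne_zero by (fastforce simp: C_def)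
  have "s \<in> cd.span C" if "s \<in> S" for s
  proof -
    have "(\<Sum>b | cd.representation B s b \<noteq> 0. pscale (cd.representation B s b) b) \<in> cd.span C"
      using that by (intro cd.span_sum cd.span_scale cd.span_base) (auto simp: C_def)
    then show ?thesis
      using cd.sum_nonzero_representation_eq[OF B(1)] B(2) by simp
  qed
  then have "cd.span C = UNIV"
    using cd.span_minimal[of S "cd.span C"] S(2) by auto
  then have rep: "cd.representation B b = cd.representation C b" for b
    by (intro cd.representation_extend B(1) CB) simp
  have "B \<subseteq> C"
  proof
    fix b assume "b \<in> B"
    then have "cd.representation C b b \<noteq> 0"
      by (simp add: cd.representation_basis[OF B(1)] flip: rep)
    then show "b \<in> C" by (rule cd.representation_ne_zero)
  qed
  with fin show ?thesis by (rule finite_subset[rotated])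
qed

locale finite_free =
  fixes B :: "'a::cdmod set"
  assumes finite_basis: "finite B" and independent_basis: "cd.independent B"
    and span_basis: "cd.span B = UNIV"
begin

text \<open>The dual basis of \<open>B\<close>. Coordinates over
  \<open>\<complex>[\<partial>]\<close> are polynomials, as values of elements of the dual have to
  be.\<close>

definition coord :: "'a \<Rightarrow> 'a cdual" where
  "coord b = Abs_chom (\<lambda>x. cd.representation B x b)"

lemma coord: "coord b \<cdot> x = cd.representation B x b"
proof -
  have "cd.representation B (x + y) b = cd.representation B x b + cd.representation B y b" for x y
    by (simp add: cd.representation_add independent_basis span_basis)
  moreover have "cd.representation B (pscale q x) b = q * cd.representation B x b" for q x
    by (simp add: cd.representation_scale independent_basis span_basis)
  from this[of "[:_:]"] this[of "[:0, 1:]"] have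
    "cd.representation B (cscale c x) b = cscale c (cd.representation B x b)"
    "cd.representation B (der x) b = [:0, 1:] * cd.representation B x b" for c x
    by (simp_all only: pscale_const pscale_var) (simp add: cscale_poly_eq_smult)
  ultimately have "conf_linear (\<lambda>x. cd.representation B x b)"
    by (simp add: conf_linear_cdual clinear_iff)
  then show ?thesis by (simp add: coord_def Abs_chom_inverse)
qed

lemma expansion: "(\<Sum>b\<in>B. pscale (coord b \<cdot> x) b) = x"
  unfolding coord by (rule cd.sum_representation_eq) (simp_all add: finite_basis independent_basis span_basis)

lemma conf_linear_expansion:
  fixes G :: "'a \<Rightarrow> complex poly"
  assumes "conf_linear G"
  shows "(\<Sum>b\<in>B. (coord b \<cdot> x) * G b) = G x"
proof -
  have lin: "clinear G" using assms by (simp add: conf_linear_def)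
  have "G x = G (\<Sum>b\<in>B. pscale (coord b \<cdot> x) b)" by (simp add: expansion)
  also have "\<dots> = (\<Sum>b\<in>B. (coord b \<cdot> x) * G b)"
    unfolding clinear_sum[OF lin] conf_linear_pscale[OF assms] ..
  finally show ?thesis by simp
qed

lemma cdual_separates:
  fixes x :: 'a
  assumes "\<And>(f :: 'a cdual) \<kappa>. poly (f \<cdot> x) \<kappa> = 0"
  shows "x = 0"
proof -
  have "coord b \<cdot> x = 0" for b
    using assms[of "coord b"] poly_all_0_iff_0 by blast
  then have "(\<Sum>b\<in>B. pscale (coord b \<cdot> x) b) = 0"
    by (simp add: pscale_0)
  then show ?thesis by (simp add: expansion)
qed

lemma cdual_separates_eq:
  fixes x y :: 'a
  assumes "\<And>(f :: 'a cdual) \<kappa>. poly (f \<cdot> x) \<kappa> = poly (f \<cdot> y) \<kappa>"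
  shows "x = y"
proof -
  have "x - y = 0"
    by (rule cdual_separates) (simp add: clinear_diff[OF clinear_cdual] assms)
  then show ?thesis by simp
qed

lemma separating_cdual: "separating {\<lambda>x :: 'a. poly (f \<cdot> x) \<kappa> | f \<kappa>. True}"
  unfolding separating_def using cdual_separates by (auto simp: clinear_cdual)

lemma separating_dual_pairing:
  "separating {dual_pairing f \<alpha> g \<gamma> :: ('a, 'a) tensor \<Rightarrow> complex | f \<alpha> g \<gamma>. True}" (is "separating ?R")
proof -
  let ?\<Phi> = "{\<lambda>x :: 'a. poly (f \<cdot> x) \<kappa> | f \<kappa>. True}"
  have "tensor_functionals ?\<Phi> ?\<Phi> \<subseteq> ?R"
  proof
    fix \<chi> assume "\<chi> \<in> tensor_functionals ?\<Phi> ?\<Phi>"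
    then obtain f \<alpha> g \<gamma> where "\<chi> = dual_pairing f \<alpha> g \<gamma>"
      unfolding tensor_functionals_def dual_pairing_def by auto
    then show "\<chi> \<in> ?R" by blast
  qed
  moreover have "\<forall>\<chi>\<in>?R. clinear \<chi>" by (auto simp: clinear_dual_pairing)
  ultimately show ?thesis
    using separating_tensor[OF separating_cdual separating_cdual] unfolding separating_def by blast
qed

text \<open>The coefficient of \<open>coord b\<close> is \<open>f \<cdot> b\<close> with its
  variable negated, because on the dual \<open>der\<close> multiplies the value at
  \<open>\<kappa>\<close> by \<open>- \<kappa>\<close>.\<close>

lemma cdual_expansion: "(\<Sum>b\<in>B. pscale (pcompose (f \<cdot> b) [:0, -1:]) (coord b)) = f"
proof (rule cdual_eqI)
  fix x \<kappa>
  have "poly ((\<Sum>b\<in>B. pscale (pcompose (f \<cdot> b) [:0, -1:]) (coord b)) \<cdot> x) \<kappa>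
      = poly (\<Sum>b\<in>B. (coord b \<cdot> x) * (f \<cdot> b)) \<kappa>"
    by (simp add: clinear_sum[OF clinear_capp_left] poly_sum poly_pscale_cdual poly_pcompose mult.commute)
  then show "poly ((\<Sum>b\<in>B. pscale (pcompose (f \<cdot> b) [:0, -1:]) (coord b)) \<cdot> x) \<kappa> = poly (f \<cdot> x) \<kappa>"
    by (simp add: conf_linear_expansion[OF capp_conf_linear])
qed

text \<open>The witness is the expansion from \<open>cdual_expansion\<close> applied to each
  \<open>G \<kappa>\<close>: a finite sum whose coefficients are polynomial in
  \<open>\<kappa>\<close> is again polynomial in \<open>\<kappa>\<close>.\<close>

lemma cdual_poly_exists:
  assumes conf: "\<And>\<kappa>. conf_linear (G \<kappa> :: 'a \<Rightarrow> complex poly)" and poly: "\<And>a. polyfun (\<lambda>\<kappa>. G \<kappa> a)"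
  shows "\<exists>p :: 'a cdual poly. \<forall>\<kappa> \<mu> a. pev (pev p \<kappa> \<cdot> a) \<mu> = poly (G \<kappa> a) \<mu>"
proof -
  have "polyfun (\<lambda>\<kappa>. \<Sum>b\<in>B. pscale (pcompose (G \<kappa> b) [:0, -1:]) (coord b))"
    by (intro polyfun_sum polyfun_linear[OF clinear_compose[OF clinear_pscale_left clinear_pcompose]] poly)
  then obtain p where p: "\<And>\<kappa>. pev p \<kappa> = (\<Sum>b\<in>B. pscale (pcompose (G \<kappa> b) [:0, -1:]) (coord b))"
    by (auto simp: polyfun_def)
  have "poly (pev p \<kappa> \<cdot> a) \<mu> = poly (G \<kappa> a) \<mu>" for \<kappa> \<mu> a
  proof -
    have "poly (pev p \<kappa> \<cdot> a) \<mu> = poly (\<Sum>b\<in>B. (coord b \<cdot> a) * G \<kappa> b) \<mu>"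
      by (simp add: p clinear_sum[OF clinear_capp_left] poly_sum poly_pscale_cdual poly_pcompose mult.commute)
    then show ?thesis by (simp add: conf_linear_expansion[OF conf])
  qed
  then show ?thesis by (auto simp: pev_complex)
qed

lemma poly_dual_product:
  assumes \<Delta>: "cd_hom (\<Delta> :: 'a \<Rightarrow> ('a, 'a) tensor)"
  shows "poly (pev (dual_product \<Delta> f g) \<kappa> \<cdot> a) \<mu> = dual_pairing f \<kappa> g (\<mu> - \<kappa>) (\<Delta> a)"
proof -
  \<comment> \<open>The pairing of \<open>f\<close> at \<open>\<kappa>\<close> and \<open>g\<close>
    at \<open>\<mu> - \<kappa>\<close>, kept as a polynomial in \<open>\<mu>\<close> so that
    \<open>cdual_poly_exists\<close> applies.\<close>
  define G where "G \<kappa> = tlift (\<lambda>(x::'a) (y::'a). cscale (poly (f \<cdot> x) \<kappa>) (pcompose (g \<cdot> y) [:- \<kappa>, 1:]))" for \<kappa>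
  have bil: "cbilinear (\<lambda>(x::'a) (y::'a). cscale (poly (f \<cdot> x) \<kappa>) (pcompose (g \<cdot> y) [:- \<kappa>, 1:]))" for \<kappa>
    by (rule cbilinearI)
      (simp_all only: capp_add capp_cscale poly_add poly_cscale pcompose_add clinear_cscale[OF clinear_pcompose]
        cscale_add_left cscale_add_right cscale_cscale mult.commute)
  have lin: "clinear (G \<kappa>)" for \<kappa>
    unfolding G_def by (rule clinear_tlift[OF bil])
  have pG: "poly (G \<kappa> t) \<mu> = dual_pairing f \<kappa> g (\<mu> - \<kappa>) t" for \<kappa> \<mu> t
    by (rule tensor_linear_eqI[OF clinear_compose[OF clinear_poly lin] clinear_dual_pairing])
      (simp add: G_def tlift_tens[OF bil] dual_pairing_tens poly_cscale poly_pcompose_shift add.commute)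
  have "polyfun (\<lambda>\<kappa>. G \<kappa> t)" for t
  proof (induct t rule: tensor_induct)
    case zero
    show ?case by (simp add: clinear_0[OF lin] polyfun_const)
  next
    case (add x y t)
    have "polyfun (\<lambda>\<kappa>. G \<kappa> (x \<otimes> y))"
      unfolding G_def tlift_tens[OF bil] by (rule polyfun_mult_cscale[OF polyfun_shift_minus])
    then show ?case
      unfolding clinear_add[OF lin] using add by (rule polyfun_add)
  qed
  moreover have "conf_linear (\<lambda>a. G \<kappa> (\<Delta> a))" for \<kappa>
    using \<Delta> clinear_compose[OF lin, of \<Delta> \<kappa>] by (simp add: conf_linear_cdual pG cd_hom_iff dual_pairing_der)
  ultimately have "\<exists>p :: 'a cdual poly. \<forall>\<kappa> \<mu> a. pev (pev p \<kappa> \<cdot> a) \<mu> = poly (G \<kappa> (\<Delta> a)) \<mu>"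
    by (intro cdual_poly_exists)
  from the_cdual_poly[OF this] show ?thesis
    by (simp add: dual_product_def pG pev_complex dual_pairing_def)
qed

lemma poly_cend_dual:
  "poly (pev (cend_dual T \<cdot> f) \<kappa> \<cdot> b) \<mu> = poly (f \<cdot> pev (T \<cdot> b) \<kappa>) (\<mu> - \<kappa>)" for T :: "'a cend"
proof -
  define D where "D f = (THE p. \<forall>\<kappa> \<mu> b. pev (pev p \<kappa> \<cdot> b) \<mu> = pev (f \<cdot> pev (T \<cdot> b) \<kappa>) (\<mu> - \<kappa>))" for f :: "'a cdual"
  have D: "poly (pev (D f) \<kappa> \<cdot> b) \<mu> = poly (f \<cdot> pev (T \<cdot> b) \<kappa>) (\<mu> - \<kappa>)" for f \<kappa> b \<mu>
  proof -
    define G where "G \<kappa> b = pcompose (f \<cdot> pev (T \<cdot> b) \<kappa>) [:- \<kappa>, 1:]" for \<kappa> b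
    have pG: "poly (G \<kappa> b) \<mu> = poly (f \<cdot> pev (T \<cdot> b) \<kappa>) (\<mu> - \<kappa>)" for \<kappa> b \<mu>
      by (simp add: G_def poly_pcompose_shift add.commute)
    have lin: "clinear (\<lambda>v. pcompose (f \<cdot> v) [:- \<kappa>, 1:])" for \<kappa>
      by (rule clinear_compose[OF clinear_pcompose clinear_capp])
    have "polyfun (\<lambda>\<kappa>. G \<kappa> b)" for b
      unfolding G_def by (rule polyfun_pev[OF lin polyfun_shift_minus])
    moreover have "conf_linear (G \<kappa>)" for \<kappa>
    proof -
      have "clinear (G \<kappa>)"
        unfolding G_def by (rule clinear_compose[OF lin clinear_compose[OF clinear_pev clinear_capp]])
      then show ?thesis
        by (simp add: conf_linear_cdual pG pev_chom_der capp_add capp_cscale poly_cscale poly_cdual_der algebra_simps)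
    qed
    ultimately have "\<exists>p :: 'a cdual poly. \<forall>\<kappa> \<mu> b. pev (pev p \<kappa> \<cdot> b) \<mu> = poly (G \<kappa> b) \<mu>"
      by (intro cdual_poly_exists)
    from the_cdual_poly[OF this] show ?thesis
      by (simp add: D_def pG pev_complex)
  qed
  have "clinear D"
    unfolding clinear_iff
    by (intro conjI allI pev_inject cdual_eqI)
      (simp_all add: clinear_add[OF clinear_pev] clinear_cscale[OF clinear_pev] D plus_chom.rep_eq
        cscale_chom.rep_eq poly_cscale)
  moreover have "pev (D (der f)) \<kappa> = der (pev (D f) \<kappa>) + cscale \<kappa> (pev (D f) \<kappa>)" for f \<kappa>
    by (rule cdual_eqI)
      (simp add: D plus_chom.rep_eq cscale_chom.rep_eq poly_cscale poly_der_cdual algebra_simps)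
  ultimately have "conf_linear D" by (simp add: conf_linear_def)
  then have "cend_dual T \<cdot> f = D f"
    unfolding cend_dual_def D_def[symmetric] by (simp add: Abs_chom_inverse)
  then show ?thesis by (simp add: D)
qed

lemma poly_cend_predual:
  "poly (h \<cdot> pev (cend_predual S \<cdot> a) \<kappa>) \<rho> = poly (pev (S \<cdot> h) \<kappa> \<cdot> a) (\<kappa> + \<rho>)" for S :: "'a cdual cend"
proof -
  define D where "D a = (THE p. \<forall>\<kappa> \<mu> h. pev (h \<cdot> pev p \<kappa>) (- \<mu>) = pev (pev (S \<cdot> h) \<kappa> \<cdot> a) (\<kappa> - \<mu>))" for a
  have unique: "p = q" if "\<And>\<kappa> \<mu> (h :: 'a cdual). poly (h \<cdot> pev p \<kappa>) (- \<mu>) = poly (h \<cdot> pev q \<kappa>) (- \<mu>)" for p q :: "'a poly"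
  proof (rule pev_inject, rule cdual_separates_eq)
    fix \<kappa> \<rho> and h :: "'a cdual"
    show "poly (h \<cdot> pev p \<kappa>) \<rho> = poly (h \<cdot> pev q \<kappa>) \<rho>"
      using that[of h \<kappa> "- \<rho>"] by simp
  qed
  have D: "poly (h \<cdot> pev (D a) \<kappa>) \<rho> = poly (pev (S \<cdot> h) \<kappa> \<cdot> a) (\<kappa> + \<rho>)" for h \<kappa> a \<rho>
  proof -
    \<comment> \<open>Testing the desired polynomial against \<open>coord b\<close> reveals its
      coordinate at \<open>b\<close>: the value of \<open>S\<close> on \<open>coord b\<close>,
      applied to \<open>a\<close> and shifted by \<open>\<kappa>\<close>.\<close>
    have "polyfun (\<lambda>\<kappa>. \<Sum>b\<in>B. pscale (pcompose (pev (S \<cdot> coord b) \<kappa> \<cdot> a) [:\<kappa>, 1:]) b)"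
    proof (intro polyfun_sum polyfun_linear[OF clinear_pscale_left])
      fix b
      show "polyfun (\<lambda>\<kappa>. pcompose (pev (S \<cdot> coord b) \<kappa> \<cdot> a) [:\<kappa>, 1:])"
        by (rule polyfun_pev[of "\<lambda>\<kappa> v. pcompose (v \<cdot> a) [:\<kappa>, 1:]"])
          (rule clinear_compose[OF clinear_pcompose clinear_capp_left] polyfun_shift_plus)+
    qed
    then obtain p where p: "\<And>\<kappa>. pev p \<kappa> = (\<Sum>b\<in>B. pscale (pcompose (pev (S \<cdot> coord b) \<kappa> \<cdot> a) [:\<kappa>, 1:]) b)"
      by (auto simp: polyfun_def)
    have "poly (h \<cdot> pev p \<kappa>) \<rho> = poly (pev (S \<cdot> h) \<kappa> \<cdot> a) (\<kappa> + \<rho>)" for \<kappa> \<rho> h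
    proof -
      have lin: "clinear (\<lambda>h. poly (pev (S \<cdot> h) \<kappa> \<cdot> a) (\<kappa> + \<rho>))"
        by (rule clinear_compose[OF clinear_cdual_left clinear_compose[OF clinear_pev clinear_capp]])
      \<comment> \<open>Conformal linearity of \<open>S\<close> contributes \<open>\<kappa>\<close>
        and \<open>der\<close> on the dual contributes \<open>- (\<kappa> + \<rho>)\<close>. What
        remains is \<open>- \<rho>\<close>, which cancels the sign in
        \<open>cdual_expansion\<close>.\<close>
      have *: "poly (pev (S \<cdot> pscale q h) \<kappa> \<cdot> a) (\<kappa> + \<rho>) = poly q (- \<rho>) * poly (pev (S \<cdot> h) \<kappa> \<cdot> a) (\<kappa> + \<rho>)" for q h
        by (induct q)
          (simp_all add: pscale_0 clinear_0[OF lin] pscale_pCons clinear_add[OF lin] clinear_cscale[OF lin]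
            cscale_complex pev_chom_der plus_chom.rep_eq cscale_chom.rep_eq poly_cscale poly_der_cdual algebra_simps)
      have "poly (h \<cdot> pev p \<kappa>) \<rho> = (\<Sum>b\<in>B. poly (pev (S \<cdot> coord b) \<kappa> \<cdot> a) (\<kappa> + \<rho>) * poly (h \<cdot> b) \<rho>)"
        by (simp add: p clinear_sum[OF clinear_capp] poly_sum capp_pscale poly_pcompose_shift)
      also have "\<dots> = poly (pev (S \<cdot> (\<Sum>b\<in>B. pscale (pcompose (h \<cdot> b) [:0, -1:]) (coord b))) \<kappa> \<cdot> a) (\<kappa> + \<rho>)"
        unfolding clinear_sum[OF lin] * by (simp add: poly_pcompose mult.commute)
      finally show ?thesis by (simp only: cdual_expansion)
    qed
    then have p: "\<forall>\<kappa> \<mu> h. pev (h \<cdot> pev p \<kappa>) (- \<mu>) = pev (pev (S \<cdot> h) \<kappa> \<cdot> a) (\<kappa> - \<mu>)"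
      by (simp add: pev_complex)
    have "\<exists>!p. \<forall>\<kappa> \<mu> h. pev (h \<cdot> pev p \<kappa>) (- \<mu>) = pev (pev (S \<cdot> h) \<kappa> \<cdot> a) (\<kappa> - \<mu>)"
    proof (rule ex1I, rule p, rule unique)
      fix q \<kappa> \<mu> and h :: "'a cdual"
      assume "\<forall>\<kappa> \<mu> h. pev (h \<cdot> pev q \<kappa>) (- \<mu>) = pev (pev (S \<cdot> h) \<kappa> \<cdot> a) (\<kappa> - \<mu>)"
      with p show "poly (h \<cdot> pev q \<kappa>) (- \<mu>) = poly (h \<cdot> pev p \<kappa>) (- \<mu>)"
        by (simp add: pev_complex)
    qed
    from theI'[OF this] have "\<forall>\<kappa> \<mu> h. pev (h \<cdot> pev (D a) \<kappa>) (- \<mu>) = pev (pev (S \<cdot> h) \<kappa> \<cdot> a) (\<kappa> - \<mu>)"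
      unfolding D_def .
    then have "pev (h \<cdot> pev (D a) \<kappa>) (- (- \<rho>)) = pev (pev (S \<cdot> h) \<kappa> \<cdot> a) (\<kappa> - - \<rho>)"
      by blast
    then show ?thesis by (simp add: pev_complex)
  qed
  have "clinear D"
    unfolding clinear_iff
    by (intro conjI allI pev_inject cdual_separates_eq)
      (simp_all add: clinear_add[OF clinear_pev] clinear_cscale[OF clinear_pev] D capp_add capp_cscale poly_cscale)
  moreover have "pev (D (der x)) \<kappa> = der (pev (D x) \<kappa>) + cscale \<kappa> (pev (D x) \<kappa>)" for x \<kappa>
    by (rule cdual_separates_eq)
      (simp add: D capp_add capp_cscale poly_cscale poly_cdual_der algebra_simps)
  ultimately have "conf_linear D" by (simp add: conf_linear_def)
  then have "cend_predual S \<cdot> a = D a"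
    unfolding cend_predual_def D_def[symmetric] by (simp add: Abs_chom_inverse)
  then show ?thesis by (simp add: D)
qed

end

section \<open>The double form\<close>

lemma poly_double_form: "poly (double_form x y) \<kappa> = poly (snd x \<cdot> fst y) \<kappa> + poly (snd y \<cdot> fst x) (- \<kappa>)"
  by (simp add: double_form_def poly_pcompose)

lemma cbilinear_double_form: "cbilinear double_form"
  by (intro cbilinearI poly_ext)
    (simp_all add: poly_double_form plus_chom.rep_eq cscale_chom.rep_eq capp_add capp_cscale cscale_prod_def
      poly_cscale algebra_simps)

lemma clinear_double_form: "clinear (double_form u)" "clinear (\<lambda>u. double_form u v)"
  by (simp_all add: clinear_iff cbilinearD[OF cbilinear_double_form])

lemma poly_double_form_der:
  "poly (double_form (der x) y) \<kappa> = - \<kappa> * poly (double_form x y) \<kappa>"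
  "poly (double_form x (der y)) \<kappa> = \<kappa> * poly (double_form x y) \<kappa>"
  by (simp_all add: poly_double_form der_prod_def poly_cdual_der poly_der_cdual algebra_simps)

lemma conformal_bilinear_double_form: "conformal_bilinear_form double_form"
  by (simp add: conformal_bilinear_form_def cbilinear_double_form poly_double_form_der)

lemma conf_linear_double_form: "conf_linear (double_form v)"
  by (simp add: conf_linear_cdual poly_double_form_der clinear_double_form)

lemma poly_double_form_sym: "poly (double_form u v) \<kappa> = poly (double_form v u) (- \<kappa>)"
  by (simp add: poly_double_form)

lemma double_form_arg_pevd:
  "poly (double_form u (pevd p \<nu>)) \<kappa> = poly (double_form u (pev p (- \<nu> - \<kappa>))) \<kappa>"
  using functional_pevd[of "\<lambda>x. poly (double_form u x) \<kappa>" \<kappa> p \<nu>]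
    clinear_compose[OF clinear_poly clinear_double_form(1), of u \<kappa>]
  by (simp add: poly_double_form_der cscale_complex)

context finite_free
begin

lemma double_form_separates:
  assumes "\<And>v \<kappa>. poly (double_form u v) \<kappa> = 0"
  shows "u = (0 :: 'a \<times> 'a cdual)"
proof -
  have "snd u = 0"
    by (rule cdual_eqI) (use assms[of "(_, 0)"] in \<open>simp add: poly_double_form chom_zero_app\<close>)
  moreover have "fst u = 0"
  proof (rule cdual_separates)
    fix f :: "'a cdual" and \<kappa>
    show "poly (f \<cdot> fst u) \<kappa> = 0"
      using assms[of "(0, f)" "- \<kappa>"] by (simp add: poly_double_form capp_zero)
  qed
  ultimately show ?thesis by (simp add: prod_eq_iff)
qed

text \<open>Surjectivity is the reflexivity of a finite free module: on the dual summand, a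
  functional \<open>F\<close> is evaluation at some \<open>x\<close>.\<close>

lemma nondegenerate_double_form: "nondegenerate (double_form :: 'a \<times> 'a cdual \<Rightarrow> _)"
proof -
  let ?T = "\<lambda>v :: 'a \<times> 'a cdual. Abs_chom (double_form v)"
  have T: "?T v \<cdot> w = double_form v w" for v w
    by (simp add: Abs_chom_inverse conf_linear_double_form)
  have hom: "cd_hom ?T"
    unfolding cd_hom_iff clinear_iff
    by (intro conjI allI cdual_eqI)
      (simp_all add: T plus_chom.rep_eq cscale_chom.rep_eq poly_der_cdual poly_double_form_der
        cbilinearD[OF cbilinear_double_form])
  moreover have "inj ?T"
  proof (rule injI)
    fix u v assume "?T u = ?T v"
    then have "double_form u w = double_form v w" for w
      by (metis T)
    then have "u - v = 0"
      by (intro double_form_separates) (simp add: clinear_diff[OF clinear_double_form(2)])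
    then show "u = v" by simp
  qed
  moreover have "F \<in> range ?T" for F
  proof -
    define f where "f = (Abs_chom (\<lambda>b. F \<cdot> (b, 0)) :: 'a cdual)"
    \<comment> \<open>The coordinates of \<open>x\<close> are forced by testing with
      \<open>coord b\<close>; the form evaluates the functional in its second argument at
      \<open>- \<kappa>\<close>, hence \<open>[:0, -1:]\<close>.\<close>
    define x where "x = (\<Sum>b\<in>B. pscale (pcompose (F \<cdot> (0, coord b)) [:0, -1:]) b)"
    have "conf_linear (\<lambda>b. F \<cdot> (b, 0))"
      unfolding conf_linear_cdual
      using clinear_compose[OF clinear_capp[of F] clinear_inl] poly_cdual_der[of F "(_, 0)"]
      by (simp add: der_prod_def clinear_0[OF clinear_der])
    then have f: "f \<cdot> b = F \<cdot> (b, 0)" for b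
      by (simp add: f_def Abs_chom_inverse)
    have g: "poly (F \<cdot> (0, g)) \<kappa> = poly (g \<cdot> x) (- \<kappa>)" for g \<kappa>
    proof -
      have lin: "clinear (\<lambda>g. poly (F \<cdot> (0, g)) \<kappa>)"
        by (rule clinear_compose[OF clinear_cdual clinear_inr])
      have *: "poly (F \<cdot> (0, pscale q g)) \<kappa> = poly q \<kappa> * poly (F \<cdot> (0, g)) \<kappa>" for q g
      proof (induct q)
        case (pCons c q)
        have "poly (F \<cdot> (0, der h)) \<kappa> = \<kappa> * poly (F \<cdot> (0, h)) \<kappa>" for h
          using poly_cdual_der[of F "(0, h)"] by (simp add: der_prod_def clinear_0[OF clinear_der])
        with pCons show ?case
          by (simp add: pscale_pCons clinear_add[OF lin] clinear_cscale[OF lin] cscale_complex algebra_simps)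
      qed (simp add: pscale_0 clinear_0[OF lin])
      have "poly (F \<cdot> (0, g)) \<kappa> = (\<Sum>b\<in>B. poly (g \<cdot> b) (- \<kappa>) * poly (F \<cdot> (0, coord b)) \<kappa>)"
        by (subst cdual_expansion[symmetric, of g], unfold clinear_sum[OF lin] *) (simp add: poly_pcompose)
      also have "\<dots> = poly (g \<cdot> x) (- \<kappa>)"
        by (simp add: x_def clinear_sum[OF clinear_capp] capp_pscale poly_sum poly_pcompose mult.commute)
      finally show ?thesis .
    qed
    have "?T (x, f) = F"
    proof (rule cdual_eqI)
      fix w \<kappa>
      have "F \<cdot> w = F \<cdot> (fst w, 0) + F \<cdot> (0, snd w)"
        by (simp flip: capp_add)
      then show "poly (?T (x, f) \<cdot> w) \<kappa> = poly (F \<cdot> w) \<kappa>"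
        unfolding T by (simp add: poly_double_form f g)
    qed
    then show ?thesis by (metis rangeI)
  qed
  ultimately show ?thesis
    unfolding nondegenerate_def bij_def by blast
qed

text \<open>Moves an operator off the tensor and onto the functional. The shift to
  \<open>\<gamma> + \<kappa>\<close> is the one in the defining equation of
  \<open>cend_dual\<close>.\<close>

lemma dual_pairing_tensor_right:
  fixes T :: "'a cend"
  shows "dual_pairing f \<alpha> g \<gamma> (pev (tensor_right T t) \<kappa>) = dual_pairing f \<alpha> (pev (cend_dual T \<cdot> g) \<kappa>) (\<gamma> + \<kappa>) t"
proof -
  have lin: "clinear (tensor_right T :: ('b::cdmod, 'a) tensor \<Rightarrow> _)"
    unfolding tensor_right_def by (rule clinear_tlift[OF cbilinear_tensor_right])
  show ?thesis
    by (rule tensor_linear_eqI[OF clinear_compose[OF clinear_dual_pairing clinear_compose[OF clinear_pev lin]] clinear_dual_pairing])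
      (simp add: tensor_right_def tlift_tens[OF cbilinear_tensor_right] pev_map_poly[OF clinear_tens(1)]
        dual_pairing_tens poly_cend_dual)
qed

lemma dual_pairing_tensor_left:
  fixes T :: "'a cend"
  shows "dual_pairing f \<alpha> g \<gamma> (pev (tensor_left T t) \<kappa>) = dual_pairing (pev (cend_dual T \<cdot> f) \<kappa>) (\<alpha> + \<kappa>) g \<gamma> t"
proof -
  have lin: "clinear (tensor_left T :: ('a, 'b::cdmod) tensor \<Rightarrow> _)"
    unfolding tensor_left_def by (rule clinear_tlift[OF cbilinear_tensor_left])
  show ?thesis
    by (rule tensor_linear_eqI[OF clinear_compose[OF clinear_dual_pairing clinear_compose[OF clinear_pev lin]] clinear_dual_pairing])
      (simp add: tensor_left_def tlift_tens[OF cbilinear_tensor_left] pev_map_poly[OF clinear_tens(2)]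
        dual_pairing_tens poly_cend_dual)
qed

end

section \<open>The double of an algebra and its dual\<close>

locale dual_algebras = finite_free B for B :: "'a::cdmod set" +
  fixes m :: "'a lambda_product" and \<Delta> :: "'a \<Rightarrow> ('a, 'a) tensor"
  assumes alg: "assoc_conformal_algebra m" and comult: "cd_hom \<Delta>"
    and dual_alg: "assoc_conformal_algebra (dual_product \<Delta>)"
begin

abbreviation "n \<equiv> dual_product \<Delta>"
abbreviation "lA \<equiv> \<lambda>a. cend_dual (R_op m a)"
abbreviation "rA \<equiv> \<lambda>a. cend_dual (L_op m a)"
abbreviation "lB \<equiv> \<lambda>f. cend_predual (R_op n f)"
abbreviation "rB \<equiv> \<lambda>f. cend_predual (L_op n f)"
abbreviation "double \<equiv> bowtie m n lA rA lB rB"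

text \<open>\<open>R_op m a\<close> multiplies \<open>c\<close> by \<open>a\<close> at
  \<open>- \<kappa> - der\<close>; under \<open>g\<close> at \<open>\<mu> - \<kappa>\<close> the
  operator \<open>der\<close> becomes \<open>\<mu> - \<kappa>\<close>, leaving
  \<open>- \<mu>\<close>. With its three companions this expresses all actions through the two
  products.\<close>

lemma poly_lA: "poly (pev (lA a \<cdot> g) \<kappa> \<cdot> c) \<mu> = poly (g \<cdot> pev (m c a) (- \<mu>)) (\<mu> - \<kappa>)"
  by (simp add: poly_cend_dual capp_R_op[OF alg] pev_pflip cdual_arg_pevd)

lemma poly_rA: "poly (pev (rA a \<cdot> g) \<kappa> \<cdot> c) \<mu> = poly (g \<cdot> pev (m a c) \<kappa>) (\<mu> - \<kappa>)"
  by (simp add: poly_cend_dual capp_L_op[OF alg])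

lemma poly_lB: "poly (h \<cdot> pev (lB f \<cdot> a) \<kappa>) \<rho> = poly (pev (n h f) \<rho> \<cdot> a) (\<kappa> + \<rho>)"
  by (simp add: poly_cend_predual capp_R_op[OF dual_alg] pev_pflip cdual_pevd)

lemma poly_rB: "poly (h \<cdot> pev (rB f \<cdot> a) \<kappa>) \<rho> = poly (pev (n f h) \<kappa> \<cdot> a) (\<kappa> + \<rho>)"
  by (simp add: poly_cend_predual capp_L_op[OF dual_alg])

lemma algs:
  "conformal_product m" "conformal_product n" "cbilinear m" "cbilinear n"
  using alg dual_alg by (simp_all add: assoc_conformal_algebra_iff conformal_product_def)

lemma product_der:
  "pev (m (der a) b) \<kappa> = - cscale \<kappa> (pev (m a b) \<kappa>)"
  "pev (m a (der b)) \<kappa> = der (pev (m a b) \<kappa>) + cscale \<kappa> (pev (m a b) \<kappa>)"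
  "pev (n (der f) g) \<kappa> = - cscale \<kappa> (pev (n f g) \<kappa>)"
  "pev (n f (der g)) \<kappa> = der (pev (n f g) \<kappa>) + cscale \<kappa> (pev (n f g) \<kappa>)"
  using algs by (simp_all add: conformal_product_def)

lemma cend_cdual_eqI:
  fixes S T :: "'a cdual cend"
  assumes "\<And>f \<kappa> b \<mu>. poly (pev (S \<cdot> f) \<kappa> \<cdot> b) \<mu> = poly (pev (T \<cdot> f) \<kappa> \<cdot> b) \<mu>"
  shows "S = T"
  by (intro chom_eqI pev_inject cdual_eqI) (rule assms)

lemma cend_eqI:
  fixes S T :: "'a cend"
  assumes "\<And>(h :: 'a cdual) a \<kappa> \<rho>. poly (h \<cdot> pev (S \<cdot> a) \<kappa>) \<rho> = poly (h \<cdot> pev (T \<cdot> a) \<kappa>) \<rho>"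
  shows "S = T"
  by (intro chom_eqI pev_inject cdual_separates_eq) (rule assms)

lemma cd_homs: "cd_hom lA" "cd_hom rA" "cd_hom lB" "cd_hom rB"
proof -
  note simps = plus_chom.rep_eq cscale_chom.rep_eq uminus_chom.rep_eq clinear_add[OF clinear_pev]
    clinear_cscale[OF clinear_pev] pev_product_linear[OF algs(3)] pev_product_linear[OF algs(4)]
    capp_add capp_cscale poly_cscale clinear_minus[OF clinear_capp]
    clinear_diff[OF clinear_capp] pev_der_chom product_der poly_cdual_der
    poly_der_cdual
  show "cd_hom lA" "cd_hom rA"
    unfolding cd_hom_iff clinear_iff
    by (intro conjI allI cend_cdual_eqI; simp add: poly_lA poly_rA simps algebra_simps)+
  show "cd_hom lB" "cd_hom rB"
    unfolding cd_hom_iff clinear_iff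
    by (intro conjI allI cend_eqI; simp add: poly_lB poly_rB simps algebra_simps)+
qed

lemma conformal_product_double: "conformal_product double"
  by (rule conformal_product_bowtie[OF algs(1,2) cd_homs])

text \<open>The actions are transposes of multiplications, so after rewriting them through
  \<open>m\<close> and \<open>n\<close> both sides consist of the same summands. This explains the
  choice of \<open>R_op\<close> for \<open>lA\<close> and \<open>lB\<close> and of
  \<open>L_op\<close> for \<open>rA\<close> and \<open>rB\<close>.\<close>

lemma double_form_invariant:
  "poly (double_form (pev (double u v) \<kappa>) w) \<mu> = poly (double_form u (pev (double v w) (\<mu> - \<kappa>))) \<kappa>"
proof -
  have "poly (h \<cdot> pevd (rB g \<cdot> a) \<kappa>) \<rho> = poly (pev (n g h) (- \<kappa> - \<rho>) \<cdot> a) (- \<kappa>)" for h g a \<kappa> \<rho>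
    by (simp add: cdual_arg_pevd poly_rB)
  moreover have "poly (pevd (rA b \<cdot> f) \<kappa> \<cdot> c) \<mu> = poly (f \<cdot> pev (m b c) (\<mu> - \<kappa>)) \<kappa>" for b f c \<kappa> \<mu>
    by (simp add: cdual_pevd poly_rA)
  ultimately show ?thesis
    by (simp add: poly_double_form pev_bowtie plus_chom.rep_eq capp_add poly_lA poly_lB)
qed

sublocale invariant_product double double_form
proof
  show "cbilinear double"
    using conformal_product_double by (simp add: conformal_product_def)
qed (fact cbilinear_double_form poly_double_form_sym double_form_separates double_form_invariant)+

lemma double_subalgebras:
  "double (a, 0) (b, 0) = map_poly (\<lambda>c. (c, 0)) (m a b)"
  "double (0, f) (0, g) = map_poly (\<lambda>h. (0, h)) (n f g)"
  by (rule pev_inject; simp add: pev_bowtie pev_map_poly[OF clinear_inl] pev_map_poly[OF clinear_inr]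
      cbilinear_zero[OF algs(3)] cbilinear_zero[OF algs(4)] capp_zero chom_zero_app cd_hom_D(4)[OF cd_homs(1)]
      cd_hom_D(4)[OF cd_homs(2)] cd_hom_D(4)[OF cd_homs(3)] cd_hom_D(4)[OF cd_homs(4)] pev_0 pevd_0)+

text \<open>\<open>double_form\<close> is conformal and nondegenerate whatever the product is. It
  also turns the \<open>\<mu> - \<partial>\<close> of the invariance axiom into
  \<open>\<mu> - \<kappa>\<close>, the shape required by \<open>invariant_product\<close>.\<close>

lemma Frobenius_double:
  "Frobenius_conformal_algebra M (double_form :: 'a \<times> 'a cdual \<Rightarrow> _) \<longleftrightarrow> assoc_conformal_algebra M \<and>
    (\<forall>u v w \<kappa> \<mu>. poly (double_form (pev (M u v) \<kappa>) w) \<mu> = poly (double_form u (pev (M v w) (\<mu> - \<kappa>))) \<kappa>)"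
  unfolding Frobenius_conformal_algebra_def
  by (simp add: conformal_bilinear_double_form nondegenerate_double_form double_form_arg_pevd)

lemma double_construction_double:
  "double_construction m n double \<longleftrightarrow> assoc_conformal_algebra double"
  unfolding double_construction_def Frobenius_double
  using double_form_invariant double_subalgebras by blast

text \<open>
  By invariance, \<open>\<langle>u\<^sub>\<kappa> v, w\<rangle>\<^sub>\<mu>\<close> is invariant under cyclic rotation, and two of three arguments lie
  in the same summand.
\<close>
lemma double_construction_unique:
  assumes "double_construction m n M"
  shows "M = double"
proof -
  have M: "assoc_conformal_algebra M"
    and inv_M: "\<And>u v w \<kappa> \<mu>. poly (double_form (pev (M u v) \<kappa>) w) \<mu> = poly (double_form u (pev (M v w) (\<mu> - \<kappa>))) \<kappa>"
    and sub: "\<And>a b. M (a, 0) (b, 0) = double (a, 0) (b, 0)" "\<And>f g. M (0, f) (0, g) = double (0, f) (0, g)"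
    using assms unfolding double_construction_def Frobenius_double double_subalgebras by blast+
  have bil: "cbilinear M" "cbilinear double"
    using M product by (simp_all add: assoc_conformal_algebra_def)
  let ?eq = "\<lambda>u v w. \<forall>\<kappa> \<mu>. poly (double_form (pev (M u v) \<kappa>) w) \<mu> = poly (double_form (pev (double u v) \<kappa>) w) \<mu>"
  have rotate: "?eq u v w" if "?eq v w u" for u v w
    unfolding inv_M inv using that by (simp add: poly_double_form_sym[of u])
  have same: "?eq u v w" if "fst u = 0 \<and> fst v = 0 \<or> snd u = 0 \<and> snd v = 0" for u v w
    using that sub by (cases u; cases v) auto
  have pure: "?eq u v w" if "fst u = 0 \<or> snd u = 0" "fst v = 0 \<or> snd v = 0" "fst w = 0 \<or> snd w = 0" for u v w
    using that same[of u v w] rotate[OF same[of v w u]] rotate[OF rotate[OF same[of w u v]]] by blast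
  have split: "x = (fst x, 0) + (0, snd x)" for x :: "'a \<times> 'a cdual" by simp
  have two: "pev (M u v) \<kappa> = pev (double u v) \<kappa>"
    if uv: "fst u = 0 \<or> snd u = 0" "fst v = 0 \<or> snd v = 0" for u v \<kappa>
  proof (rule form_eqI)
    fix w \<mu>
    have w: "double_form x w = double_form x (fst w, 0) + double_form x (0, snd w)" for x :: "'a \<times> 'a cdual"
      by (subst split[of w], rule cbilinearD(3)[OF form])
    show "poly (double_form (pev (M u v) \<kappa>) w) \<mu> = poly (double_form (pev (double u v) \<kappa>) w) \<mu>"
      unfolding w using pure[OF uv, of "(fst w, 0)"] pure[OF uv, of "(0, snd w)"] by simp
  qed
  have one: "pev (M u v) \<kappa> = pev (double u v) \<kappa>" if "fst u = 0 \<or> snd u = 0" for u v \<kappa>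
    by (subst (1 2) split[of v], unfold pev_product_linear(2)[OF bil(1)] pev_product_linear(2)[OF bil(2)])
      (simp add: two that)
  show ?thesis
  proof (intro ext pev_inject)
    fix u v \<kappa>
    show "pev (M u v) \<kappa> = pev (double u v) \<kappa>"
      by (subst (1 2) split[of u], unfold pev_product_linear(1)[OF bil(1)] pev_product_linear(1)[OF bil(2)])
        (simp add: one)
  qed
qed

lemma double_construction_iff_associative:
  "(\<exists>M. double_construction m n M) \<longleftrightarrow> assoc_conformal_algebra double"
  using double_construction_unique double_construction_double by metis

lemma pev_double_pure:
  "pev (double (a, 0) (b, 0)) \<kappa> = (pev (m a b) \<kappa>, 0)"
  "pev (double (0, f) (0, g)) \<kappa> = (0, pev (n f g) \<kappa>)"
  "pev (double (a, 0) (0, g)) \<kappa> = (pevd (rB g \<cdot> a) \<kappa>, pev (lA a \<cdot> g) \<kappa>)"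
  "pev (double (0, f) (b, 0)) \<kappa> = (pev (lB f \<cdot> b) \<kappa>, pevd (rA b \<cdot> f) \<kappa>)"
  by (simp_all add: pev_bowtie cbilinear_zero[OF algs(3)] cbilinear_zero[OF algs(4)] capp_zero chom_zero_app
      cd_hom_D(4)[OF cd_homs(1)] cd_hom_D(4)[OF cd_homs(2)] cd_hom_D(4)[OF cd_homs(3)]
      cd_hom_D(4)[OF cd_homs(4)] pev_0 pevd_0)

lemma associative_double_iff:
  "assoc_conformal_algebra double \<longleftrightarrow>
    (\<forall>a b f g k l r s. k + l + r + s = 0 \<longrightarrow> cyclic (a, 0) k (b, 0) l (0, f) r (0, g) s) \<and>
    (\<forall>a b f g k l r s. k + l + r + s = 0 \<longrightarrow> cyclic (a, 0) k (0, f) l (b, 0) r (0, g) s)"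
proof
  assume "assoc_conformal_algebra double"
  then have "cyclic u k v l w r z s" if "k + l + r + s = 0" for u v w z k l r s
    using that associative_iff_cyclic unfolding assoc_conformal_algebra_iff by blast
  then show "(\<forall>a b f g k l r s. k + l + r + s = 0 \<longrightarrow> cyclic (a, 0) k (b, 0) l (0, f) r (0, g) s) \<and>
    (\<forall>a b f g k l r s. k + l + r + s = 0 \<longrightarrow> cyclic (a, 0) k (0, f) l (b, 0) r (0, g) s)"
    by blast
next
  assume *: "(\<forall>a b f g k l r s. k + l + r + s = 0 \<longrightarrow> cyclic (a, 0) k (b, 0) l (0, f) r (0, g) s) \<and>
    (\<forall>a b f g k l r s. k + l + r + s = 0 \<longrightarrow> cyclic (a, 0) k (0, f) l (b, 0) r (0, g) s)"
  have pure: "cyclic u k v l w r z s"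
    if sum: "k + l + r + s = 0" and uvwz: "snd u = 0 \<or> fst u = 0" "snd v = 0 \<or> fst v = 0"
      "snd w = 0 \<or> fst w = 0" "snd z = 0 \<or> fst z = 0" for u v w z k l r s
  proof (rule cyclic_words[where P = "\<lambda>u. snd u = 0" and N = "\<lambda>u. fst u = 0", OF _ _ _ _ sum uvwz])
    show "pev (double (pev (double u v) \<kappa>) w) (\<kappa> + \<mu>) = pev (double u (pev (double v w) \<mu>)) \<kappa>"
      if "snd u = 0" "snd v = 0" "snd w = 0" for u v w \<kappa> \<mu>
      using that alg by (cases u; cases v; cases w) (simp add: pev_double_pure assoc_conformal_algebra_iff)
    show "pev (double (pev (double u v) \<kappa>) w) (\<kappa> + \<mu>) = pev (double u (pev (double v w) \<mu>)) \<kappa>"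
      if "fst u = 0" "fst v = 0" "fst w = 0" for u v w \<kappa> \<mu>
      using that dual_alg by (cases u; cases v; cases w) (simp add: pev_double_pure assoc_conformal_algebra_iff)
    show "cyclic u k v l w r z s" if "k + l + r + s = 0" "snd u = 0" "snd v = 0" "fst w = 0" "fst z = 0"
      for u v w z k l r s
      using that * by (cases u; cases v; cases w; cases z) simp
    show "cyclic u k v l w r z s" if "k + l + r + s = 0" "snd u = 0" "fst v = 0" "snd w = 0" "fst z = 0"
      for u v w z k l r s
      using that * by (cases u; cases v; cases w; cases z) simp
  qed
  have "pev (double (pev (double u v) \<kappa>) w) (\<kappa> + \<mu>) = pev (double u (pev (double v w) \<mu>)) \<kappa>" for u v w \<kappa> \<mu>
  proof (rule associative_prodI[OF product])
    fix u v w :: "'a \<times> 'a cdual" and \<kappa> \<mu>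
    assume uvw: "fst u = 0 \<or> snd u = 0" "fst v = 0 \<or> snd v = 0" "fst w = 0 \<or> snd w = 0"
    show "pev (double (pev (double u v) \<kappa>) w) (\<kappa> + \<mu>) = pev (double u (pev (double v w) \<mu>)) \<kappa>"
      unfolding associative_iff_cyclic
    proof (intro allI impI)
      fix r s and z :: "'a \<times> 'a cdual"
      assume "\<kappa> + \<mu> + r + s = 0"
      \<comment> \<open>\<open>associative_prodI\<close> makes only the three factors homogeneous;
        the test vector \<open>z\<close> is split by \<open>cyclic_add\<close>.\<close>
      then have "cyclic u \<kappa> v \<mu> w r ((fst z, 0) + (0, snd z)) s"
        using uvw by (intro cyclic_add pure) auto
      then show "cyclic u \<kappa> v \<mu> w r z s" by simp
    qed
  qed
  then show "assoc_conformal_algebra double"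
    using conformal_product_double by (simp add: assoc_conformal_algebra_iff)
qed

lemma poly_dual: "poly (pev (n f g) \<kappa> \<cdot> a) \<mu> = dual_pairing f \<kappa> g (\<mu> - \<kappa>) (\<Delta> a)"
  by (rule poly_dual_product[OF comult])

text \<open>The form of \<open>a b\<close> against \<open>f g\<close> gives the left side. In the
  rotated value, \<open>b f\<close> against \<open>g a\<close>, the summand through
  \<open>lA\<close> and \<open>lB\<close> becomes \<open>R_op m b\<close> on the left factor of
  \<open>\<Delta> a\<close>, and the one through \<open>rB\<close> and \<open>rA\<close> becomes
  \<open>L_op m a\<close> on the right factor of \<open>\<Delta> b\<close>.\<close>

lemma cyclic_AABB:
  assumes "k + l + r + s = 0"
  shows "cyclic (a, 0) k (b, 0) l (0, f) r (0, g) s \<longleftrightarrow>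
    dual_pairing f r g s (\<Delta> (pev (m a b) k)) =
    dual_pairing f r g s (pev (tensor_right (L_op m a) (\<Delta> b)) k + pevd (tensor_left (R_op m b) (\<Delta> a)) k)"
proof -
  have s: "s = - k - l - r" using minus_unique[OF assms] by simp
  show ?thesis
    by (simp add: cyclic_def four_point_def pev_double_pure poly_double_form chom_zero_app capp_zero
        cdual_arg_pevd poly_lB poly_rB poly_dual clinear_add[OF clinear_dual_pairing] dual_pairing_pevd
        dual_pairing_tensor_right dual_pairing_tensor_left dual_pairing_pevd_left dual_pairing_pevd_right
        s algebra_simps)
qed

text \<open>Each four-point value has two summands: \<open>a f\<close> against \<open>b g\<close>
  gives the terms with \<open>R_op\<close>, and \<open>f b\<close> against \<open>g a\<close> those
  with \<open>L_op\<close>. In the terms from \<open>\<Delta> b\<close> it is \<open>g\<close> that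
  meets the first tensor factor, which is the source of \<open>tswap\<close>.\<close>

lemma cyclic_ABAB:
  assumes "k + l + r + s = 0"
  shows "cyclic (a, 0) k (0, f) l (b, 0) r (0, g) s \<longleftrightarrow>
    dual_pairing f l g s
      ((pevd (tensor_left (L_op m b) (\<Delta> a)) k - pevd (tensor_right (R_op m b) (\<Delta> a)) k) +
       tswap (pev (tensor_left (L_op m a) (\<Delta> b)) k - pev (tensor_right (R_op m a) (\<Delta> b)) k)) = 0"
proof -
  have s: "s = - k - l - r" using minus_unique[OF assms] by simp
  have r: "- r - (k + l) = - k - (l + r)" by simp
  show ?thesis
    by (auto simp: cyclic_def four_point_def pev_double_pure poly_double_form 
        cdual_arg_pevd poly_lB poly_rB poly_dual clinear_add[OF clinear_dual_pairing]
        clinear_diff[OF clinear_dual_pairing] dual_pairing_tswap dual_pairing_pevd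
        dual_pairing_tensor_right dual_pairing_tensor_left dual_pairing_pevd_left dual_pairing_pevd_right
        s r algebra_simps)
qed

lemma tensor_eq_iff_dual_pairing:
  "s = t \<longleftrightarrow> (\<forall>f \<alpha> g \<gamma>. dual_pairing f \<alpha> g \<gamma> s = dual_pairing f \<alpha> g \<gamma> t)" for s t :: "('a, 'a) tensor"
  using separating_eqI[OF separating_dual_pairing, of s t] by blast

text \<open>Paired with \<open>f\<close>, \<open>g\<close>, \<open>h\<close> on the three factors,
  coassociativity becomes the equation between \<open>(f g) h\<close> and \<open>f (g h)\<close> in
  the dual algebra. Such triple products separate the points of the triple tensor product, by
  \<open>separating_tensor\<close> applied twice.\<close>

lemma coassociative: "assoc_conformal_coalgebra \<Delta>"
  unfolding assoc_conformal_coalgebra_def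
proof (intro conjI allI comult)
  fix a
  let ?\<Psi> = "{dual_pairing f \<alpha> g \<gamma> :: ('a, 'a) tensor \<Rightarrow> complex | f \<alpha> g \<gamma>. True}"
  have \<Delta>: "clinear \<Delta>" using comult by (simp add: cd_hom_iff)
  have right: "cbilinear (\<lambda>x y. id x \<otimes> \<Delta> y)" and left: "cbilinear (\<lambda>x y. \<Delta> x \<otimes> id y)"
    and assoc: "cbilinear (\<lambda>(x::'a) y. x \<otimes> (y \<otimes> c))" for c :: 'a
    by (rule cbilinearI; simp add: clinear_add[OF \<Delta>] clinear_cscale[OF \<Delta>] cbilinearD[OF cbilinear_tens])+
  have assoc': "cbilinear (\<lambda>t (c::'a). tlift (\<lambda>(x::'a) (y::'a). x \<otimes> (y \<otimes> c)) t)"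
  proof (rule cbilinearI)
    fix t and c c' :: 'a and d
    note lin = clinear_tlift[OF assoc]
    have "clinear (\<lambda>t. tlift (\<lambda>(x::'a) (y::'a). x \<otimes> (y \<otimes> c)) t + tlift (\<lambda>x y. x \<otimes> (y \<otimes> c')) t)"
      by (simp add: clinear_iff clinear_add[OF lin] clinear_cscale[OF lin] cscale_add_right)
    then show "tlift (\<lambda>(x::'a) (y::'a). x \<otimes> (y \<otimes> (c + c'))) t
        = tlift (\<lambda>x y. x \<otimes> (y \<otimes> c)) t + tlift (\<lambda>x y. x \<otimes> (y \<otimes> c')) t"
      by (rule tensor_linear_eqI[OF lin], unfold tlift_tens[OF assoc]) (simp add: cbilinearD[OF cbilinear_tens])
    show "tlift (\<lambda>(x::'a) (y::'a). x \<otimes> (y \<otimes> cscale d c)) t = cscale d (tlift (\<lambda>x y. x \<otimes> (y \<otimes> c)) t)"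
      by (rule tensor_linear_eqI[OF lin clinear_compose[OF clinear_cscale_fun lin]], unfold tlift_tens[OF assoc])
        (simp add: cbilinearD[OF cbilinear_tens])
  qed (simp_all add: clinear_add[OF clinear_tlift[OF assoc]] clinear_cscale[OF clinear_tlift[OF assoc]])
  show "tmap id \<Delta> (\<Delta> a) = tassoc (tmap \<Delta> id (\<Delta> a))"
  proof (rule separating_eqI[OF separating_tensor[OF separating_cdual separating_dual_pairing]])
    fix \<chi> assume "\<chi> \<in> tensor_functionals {\<lambda>x :: 'a. poly (f \<cdot> x) \<kappa> | f \<kappa>. True} ?\<Psi>"
    then obtain f \<kappa> g \<mu> h \<nu> where \<chi>: "\<chi> = tlift (\<lambda>x t. poly (f \<cdot> x) \<kappa> * dual_pairing g \<mu> h \<nu> t)"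
      unfolding tensor_functionals_def by auto
    note lin = clinear_tlift_product[OF clinear_cdual clinear_dual_pairing]
    note tens = tlift_product_tens[OF clinear_cdual clinear_dual_pairing]
    have "\<chi> (tmap id \<Delta> t) = dual_pairing f \<kappa> (pev (n g h) \<mu>) (\<mu> + \<nu>) t" for t
      unfolding \<chi> tmap_def
      by (rule tensor_linear_eqI[OF clinear_compose[OF lin clinear_tlift[OF right]] clinear_dual_pairing],
          unfold tlift_tens[OF right]) (simp add: tens dual_pairing_tens poly_dual)
    moreover have "\<chi> (tassoc (tmap \<Delta> id t)) = dual_pairing (pev (n f g) \<kappa>) (\<kappa> + \<mu>) h \<nu> t" for t
    proof -
      have inner: "\<chi> (tlift (\<lambda>x y. x \<otimes> (y \<otimes> c)) t) = dual_pairing f \<kappa> g \<mu> t * poly (h \<cdot> c) \<nu>" for t c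
      proof -
        have "clinear (\<lambda>t. poly (h \<cdot> c) \<nu> * dual_pairing f \<kappa> g \<mu> t)"
          by (rule clinear_compose[OF clinear_cmult clinear_dual_pairing])
        then have "\<chi> (tlift (\<lambda>x y. x \<otimes> (y \<otimes> c)) t) = poly (h \<cdot> c) \<nu> * dual_pairing f \<kappa> g \<mu> t"
          unfolding \<chi>
          by (rule tensor_linear_eqI[OF clinear_compose[OF lin clinear_tlift[OF assoc]]])
            (simp add: tlift_tens[OF assoc] tens dual_pairing_tens)
        then show ?thesis by (simp add: mult.commute)
      qed
      have "clinear \<chi>" unfolding \<chi> by (rule lin)
      then have "clinear (\<lambda>t. \<chi> (tassoc (tmap \<Delta> id t)))"
        unfolding tassoc_def tmap_def
        by (rule clinear_compose[OF _ clinear_compose[OF clinear_tlift[OF assoc'] clinear_tlift[OF left]]])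
      then show ?thesis
        by (rule tensor_linear_eqI[OF _ clinear_dual_pairing],
            unfold tmap_def tassoc_def tlift_tens[OF left] tlift_tens[OF assoc'])
          (simp add: inner dual_pairing_tens poly_dual)
    qed
    moreover have "dual_pairing f \<kappa> (pev (n g h) \<mu>) (\<mu> + \<nu>) (\<Delta> a) = dual_pairing (pev (n f g) \<kappa>) (\<kappa> + \<mu>) h \<nu> (\<Delta> a)"
    proof -
      have "pev (n (pev (n f g) \<kappa>) h) (\<kappa> + \<mu>) = pev (n f (pev (n g h) \<mu>)) \<kappa>"
        using dual_alg by (simp add: assoc_conformal_algebra_iff)
      from arg_cong[OF this, of "\<lambda>F. poly (F \<cdot> a) (\<kappa> + \<mu> + \<nu>)"] show ?thesis
        by (simp add: poly_dual add.assoc)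
    qed
    ultimately show "\<chi> (tmap id \<Delta> (\<Delta> a)) = \<chi> (tassoc (tmap \<Delta> id (\<Delta> a)))"
      by simp
  qed
qed

lemma ASI_iff_associative: "ASI_conformal_bialgebra m \<Delta> \<longleftrightarrow> assoc_conformal_algebra double"
proof -
  \<comment> \<open>The pairing leaves the parameters \<open>r\<close> of \<open>f\<close> and
    \<open>s\<close> of \<open>g\<close> free. Giving the remaining argument the parameter
    \<open>- k - r - s\<close> makes the sum zero, so every pairing is reached by some cyclic
    word.\<close>
  have sum: "k + (- k - r - s) + r + s = 0" "k + r + (- k - r - s) + s = 0" for k r s :: complex
    by simp_all
  have ASI1: "(\<forall>a b \<kappa>. \<Delta> (pev (m a b) \<kappa>) = pev (tensor_right (L_op m a) (\<Delta> b)) \<kappa> + pevd (tensor_left (R_op m b) (\<Delta> a)) \<kappa>)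
    \<longleftrightarrow> (\<forall>a b f g k l r s. k + l + r + s = 0 \<longrightarrow> cyclic (a, 0) k (b, 0) l (0, f) r (0, g) s)"
    (is "?ASI1 \<longleftrightarrow> ?AABB")
  proof
    show ?AABB if ?ASI1
      using that cyclic_AABB by metis
    show ?ASI1 if ?AABB
      unfolding tensor_eq_iff_dual_pairing using that cyclic_AABB[OF sum(1)] sum(1) by blast
  qed
  have ASI2: "(\<forall>a b \<kappa>.
        (pevd (tensor_left (L_op m b) (\<Delta> a)) \<kappa> - pevd (tensor_right (R_op m b) (\<Delta> a)) \<kappa>) +
        tswap (pev (tensor_left (L_op m a) (\<Delta> b)) \<kappa> - pev (tensor_right (R_op m a) (\<Delta> b)) \<kappa>) = 0)
    \<longleftrightarrow> (\<forall>a b f g k l r s. k + l + r + s = 0 \<longrightarrow> cyclic (a, 0) k (0, f) l (b, 0) r (0, g) s)"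
    (is "?ASI2 \<longleftrightarrow> ?ABAB")
  proof
    show ?ABAB if ?ASI2
      using that cyclic_ABAB clinear_0[OF clinear_dual_pairing] by metis
    show ?ASI2 if ?ABAB
      unfolding tensor_eq_iff_dual_pairing clinear_0[OF clinear_dual_pairing]
      using that cyclic_ABAB[OF sum(2)] sum(2) by blast
  qed
  show ?thesis
    unfolding ASI_conformal_bialgebra_def associative_double_iff
    by (simp only: alg coassociative ASI1 ASI2 simp_thms)
qed

end

theorem corollary4p8:
  fixes m :: "'a::cdmod lambda_product" and \<Delta> :: "'a \<Rightarrow> ('a, 'a) tensor"
  assumes "assoc_conformal_algebra m"
    and "\<exists>S :: 'a set. finite S \<and> cd.span S = UNIV"
    and "\<exists>B :: 'a set. cd.independent B \<and> cd.span B = UNIV"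
    and "cd_hom \<Delta>"
    and "assoc_conformal_algebra (dual_product \<Delta>)"
  shows "(ASI_conformal_bialgebra m \<Delta> \<longleftrightarrow> (\<exists>M. double_construction m (dual_product \<Delta>) M)) \<and>
    ((\<exists>M. double_construction m (dual_product \<Delta>) M) \<longleftrightarrow>
      matched_pair m (dual_product \<Delta>)
        (\<lambda>a. cend_dual (R_op m a)) (\<lambda>a. cend_dual (L_op m a))
        (\<lambda>f. cend_predual (R_op (dual_product \<Delta>) f)) (\<lambda>f. cend_predual (L_op (dual_product \<Delta>) f)))"
proof -
  obtain S B :: "'a set" where S: "finite S" "cd.span S = UNIV" and B: "cd.independent B" "cd.span B = UNIV"
    using assms(2,3) by blast
  have "finite B" by (rule finite_basis_of_finite_span[OF S B])
  then interpret dual_algebras B m \<Delta>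
    by (intro dual_algebras.intro finite_free.intro dual_algebras_axioms.intro assms B)
  show ?thesis
    using ASI_iff_associative double_construction_iff_associative
      assoc_bowtie_iff_matched_pair[OF assms(1,5) cd_homs] by blast
qed

end
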